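(* Let $\delta>0$, and let $(\mathbf u(t),\mathbf x(t))$, with $\mathbf u=(u_1,\dots,u_{N-1})^T$, $\mathbf x=(x_1,\dots,x_{N-1})^T$ and $a<x_1(t)<\dots<x_{N-1}(t)<b$, be a solution of the stabilized moving finite element ODE system $$\begin{pmatrix}\mathbf A&\mathbf B\\ \mathbf B&\mathbf C+\delta\mathbf I\end{pmatrix}\begin{pmatrix}\dot{\mathbf u}\\ \dot{\mathbf x}\end{pmatrix}=\begin{pmatrix}\mathbf f\\ \mathbf g\end{pmatrix},$$ where $\mathbf A,\mathbf B,\mathbf C,\mathbf f,\mathbf g$ depend on $(\mathbf u,\mathbf x)$ as defined in the context. Let $u_h(t,x)\in V_h^N$ be the corresponding piecewise linear function. Then $$\frac{d\,\mathcal E(u_h)}{dt}\le 0,$$ and equality holds (at a given time) only when $\dot x_k=0$ and $\dot u_k=0$ for all $k=1,\dots,N-1$ (at that time).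
   Context: Let $I=(a,b)$ be a bounded interval, $\alpha>0$, $\xi>0$ constants, and $N\ge 2$ an integer. Let $F:I\times\mathbb R\to\mathbb R$ have partial derivative $f(x,u)=\partial_uF(x,u)$ satisfying $|f(x,v)-f(x,w)|\le L_0|v-w|$ for all $x\in I$ and $v,w\in\mathbb R$, with a constant $L_0>0$; it is assumed that for all $u,v\in H_0^1(I)$ the functions $F(\cdot,u(\cdot))$ and $f(\cdot,u(\cdot))\,v(\cdot)$ are integrable on $I$. The energy is $$\mathcal E(u)=\int_I \frac{\alpha}{2}(\partial_xu)^2+F(x,u)\,dx,\qquad u\in H^1_0(I).$$ Free-knot piecewise linear functions: for nodes $a=x_0<x_1<\dots<x_N=b$ put $I_k=(x_{k-1},x_k)$, and let $\phi_k$ ($1\le k\le N-1$) be the nodal hat function $$\phi_k(x)=\frac{x-x_{k-1}}{x_k-x_{k-1}}\chi_{I_k}(x)+\frac{x_{k+1}-x}{x_{k+1}-x_k}\chi_{I_{k+1}}(x),$$ where $\chi_J$ is the characteristic function of $J$. $V_h^N$ is the set of all continuous functions on $[a,b]$, vanishing at $a$ and $b$, that are linear on each $I_k$ for some such choice of nodes. The function corresponding to $(\mathbf u,\mathbf x)$ is $u_h=\sum_{k=1}^{N-1}u_k\phi_k$, with the convention $u_0=u_N=0$. Put $D_hu_k=\frac{u_{k+1}-u_k}{x_{k+1}-x_k}$ and $$\beta_k(x)=\frac{\partial u_h}{\partial x_k}=-D_hu_{k-1}\frac{x-x_{k-1}}{x_k-x_{k-1}}\chi_{I_k}(x)-D_hu_k\frac{x_{k+1}-x}{x_{k+1}-x_k}\chi_{I_{k+1}}(x).$$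 Matrices: $\mathbf A,\mathbf B,\mathbf C$ are the $(N-1)\times(N-1)$ tridiagonal matrices with entries $a_{jk}=\int_I\phi_j\phi_k\,dx$, $b_{jk}=\int_I\phi_j\beta_k\,dx$, $c_{jk}=\int_I\beta_j\beta_k\,dx$ (one has $b_{jk}=b_{kj}$); $\mathbf I$ is the identity matrix. Right-hand side: with $\mathcal E_h(u_1,\dots,u_{N-1},x_1,\dots,x_{N-1}):=\mathcal E(u_h)$, the vectors $\mathbf f=(f_1,\dots,f_{N-1})^T$ and $\mathbf g=(g_1,\dots,g_{N-1})^T$ are $$f_k=-\frac1\xi\frac{\partial\mathcal E_h}{\partial u_k}=-\frac1\xi\int_I\alpha\,\partial_xu_h\,\partial_x\phi_k+f(x,u_h)\phi_k\,dx,$$ $$g_k=-\frac1\xi\frac{\partial\mathcal E_h}{\partial x_k}=-\frac1\xi\Big(\int_I\alpha\,\partial_xu_h\,\partial_x\beta_k+f(x,u_h)\beta_k\,dx-\frac\alpha2\big[(\partial_xu_h)^2\big]\big|_{x_k}\Big),$$ where $\partial_x\beta_k$ is taken elementwise and $[(\partial_xu_h)^2]|_{x_k}=(\partial_xu_h)^2|_{I_{k+1}}-(\partial_xu_h)^2|_{I_k}$. *)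

theory Defs
  imports "HOL-Analysis.Analysis" "Jordan_Normal_Form.Matrix"
begin

definition test_function :: "real \<Rightarrow> real \<Rightarrow> (real \<Rightarrow> real) \<Rightarrow> bool" where
  "test_function a b \<phi> \<longleftrightarrow>
     (\<forall>n x. (deriv ^^ n) \<phi> differentiable (at x)) \<and>
     compact (closure {x. \<phi> x \<noteq> 0}) \<and> closure {x. \<phi> x \<noteq> 0} \<subseteq> {a<..<b}"

definition sq_integrable :: "real \<Rightarrow> real \<Rightarrow> (real \<Rightarrow> real) \<Rightarrow> bool" where
  "sq_integrable a b g \<longleftrightarrow>
     set_borel_measurable lebesgue {a<..<b} g \<and>
     set_integrable lebesgue {a<..<b} (\<lambda>x. (g x)\<^sup>2)"

definition weak_derivative :: "real \<Rightarrow> real \<Rightarrow> (real \<Rightarrow> real) \<Rightarrow> (real \<Rightarrow> real) \<Rightarrow> bool" where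
  "weak_derivative a b u g \<longleftrightarrow>
     (\<forall>\<phi>. test_function a b \<phi> \<longrightarrow>
        (LINT x:{a<..<b}|lebesgue. u x * deriv \<phi> x) = - (LINT x:{a<..<b}|lebesgue. g x * \<phi> x))"

definition H1 :: "real \<Rightarrow> real \<Rightarrow> (real \<Rightarrow> real) set" where
  "H1 a b = {u. sq_integrable a b u \<and> (\<exists>g. sq_integrable a b g \<and> weak_derivative a b u g)}"

text \<open>
  In one dimension every class in \<open>H1\<close> has a unique representative that is continuous on
  \<open>[a, b]\<close>. The elements of \<open>H10\<close> are these representatives, so that the zero boundary values
  are meant pointwise.
\<close>

definition H10 :: "real \<Rightarrow> real \<Rightarrow> (real \<Rightarrow> real) set" where
  "H10 a b = {u \<in> H1 a b. continuous_on {a..b} u \<and> u a = 0 \<and> u b = 0}"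

text \<open>
  The continuous representative of an element of \<open>H1\<close> is absolutely continuous; its pointwise
  derivative exists almost everywhere and is its weak derivative, hence \<open>deriv u\<close> below. For
  piecewise linear \<open>u\<close> this is the elementwise derivative (the finitely many nodes do not matter).
\<close>

definition energy ::
  "real \<Rightarrow> real \<Rightarrow> real \<Rightarrow> (real \<Rightarrow> real \<Rightarrow> real) \<Rightarrow> (real \<Rightarrow> real) \<Rightarrow> real" where
  "energy a b \<alpha> F u = (LINT x:{a<..<b}|lebesgue. \<alpha> / 2 * (deriv u x)\<^sup>2 + F x (u x))"

text \<open>
  The unknowns \<open>u, x :: nat \<Rightarrow> real\<close> are used at the indices \<open>1, ..., N - 1\<close> only; the two
  functions below add the conventions \<open>x\<^sub>0 = a\<close>, \<open>x\<^sub>N = b\<close> and \<open>u\<^sub>0 = u\<^sub>N = 0\<close>.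
\<close>

definition nodes :: "real \<Rightarrow> real \<Rightarrow> nat \<Rightarrow> (nat \<Rightarrow> real) \<Rightarrow> nat \<Rightarrow> real" where
  "nodes a b N x k = (if k = 0 then a else if k = N then b else x k)"

definition vals :: "nat \<Rightarrow> (nat \<Rightarrow> real) \<Rightarrow> nat \<Rightarrow> real" where
  "vals N u k = (if k = 0 \<or> k = N then 0 else u k)"

text \<open>
  Below, \<open>X\<close> is a full node vector and \<open>U\<close> a full vector of nodal values. In \<open>hat\<close> the node
  \<open>X k\<close> is attached to the left element, which makes \<open>hat X k\<close> the continuous function with
  value 1 there. In contrast, \<open>beta U X k\<close> has a jump at \<open>X k\<close>.
\<close>

definition hat :: "(nat \<Rightarrow> real) \<Rightarrow> nat \<Rightarrow> real \<Rightarrow> real" where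
  "hat X k y =
     (y - X (k - 1)) / (X k - X (k - 1)) * indicator {X (k - 1)<..X k} y +
     (X (k + 1) - y) / (X (k + 1) - X k) * indicator {X k<..<X (k + 1)} y"

definition Dh :: "(nat \<Rightarrow> real) \<Rightarrow> (nat \<Rightarrow> real) \<Rightarrow> nat \<Rightarrow> real" where
  "Dh U X k = (U (k + 1) - U k) / (X (k + 1) - X k)"

definition beta :: "(nat \<Rightarrow> real) \<Rightarrow> (nat \<Rightarrow> real) \<Rightarrow> nat \<Rightarrow> real \<Rightarrow> real" where
  "beta U X k y =
     - Dh U X (k - 1) * ((y - X (k - 1)) / (X k - X (k - 1))) * indicator {X (k - 1)<..<X k} y
     - Dh U X k * ((X (k + 1) - y) / (X (k + 1) - X k)) * indicator {X k<..<X (k + 1)} y"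

definition uh :: "real \<Rightarrow> real \<Rightarrow> nat \<Rightarrow> (nat \<Rightarrow> real) \<Rightarrow> (nat \<Rightarrow> real) \<Rightarrow> real \<Rightarrow> real" where
  "uh a b N u x y = (\<Sum>k = 1..N - 1. u k * hat (nodes a b N x) k y)"

definition Eh ::
  "real \<Rightarrow> real \<Rightarrow> real \<Rightarrow> (real \<Rightarrow> real \<Rightarrow> real) \<Rightarrow> nat \<Rightarrow> (nat \<Rightarrow> real) \<Rightarrow> (nat \<Rightarrow> real) \<Rightarrow> real" where
  "Eh a b \<alpha> F N u x = energy a b \<alpha> F (uh a b N u x)"

text \<open>
  Matrices and vectors of dimension \<open>N - 1\<close> are indexed from 0, so position \<open>i\<close> belongs to the
  node with index \<open>i + 1\<close>.
\<close>

definition to_vec :: "nat \<Rightarrow> (nat \<Rightarrow> real) \<Rightarrow> real Matrix.vec" where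
  "to_vec N v = Matrix.vec (N - 1) (\<lambda>i. v (i + 1))"

definition matA :: "real \<Rightarrow> real \<Rightarrow> nat \<Rightarrow> (nat \<Rightarrow> real) \<Rightarrow> real Matrix.mat" where
  "matA a b N x =
     (let X = nodes a b N x in
      Matrix.mat (N - 1) (N - 1)
        (\<lambda>(i, j). LINT y:{a<..<b}|lebesgue. hat X (i + 1) y * hat X (j + 1) y))"

definition matB :: "real \<Rightarrow> real \<Rightarrow> nat \<Rightarrow> (nat \<Rightarrow> real) \<Rightarrow> (nat \<Rightarrow> real) \<Rightarrow> real Matrix.mat" where
  "matB a b N u x =
     (let X = nodes a b N x; U = vals N u in
      Matrix.mat (N - 1) (N - 1)
        (\<lambda>(i, j). LINT y:{a<..<b}|lebesgue. hat X (i + 1) y * beta U X (j + 1) y))"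

definition matC :: "real \<Rightarrow> real \<Rightarrow> nat \<Rightarrow> (nat \<Rightarrow> real) \<Rightarrow> (nat \<Rightarrow> real) \<Rightarrow> real Matrix.mat" where
  "matC a b N u x =
     (let X = nodes a b N x; U = vals N u in
      Matrix.mat (N - 1) (N - 1)
        (\<lambda>(i, j). LINT y:{a<..<b}|lebesgue. beta U X (i + 1) y * beta U X (j + 1) y))"

definition rhs_f ::
  "real \<Rightarrow> real \<Rightarrow> real \<Rightarrow> real \<Rightarrow> (real \<Rightarrow> real \<Rightarrow> real) \<Rightarrow> nat \<Rightarrow>
   (nat \<Rightarrow> real) \<Rightarrow> (nat \<Rightarrow> real) \<Rightarrow> nat \<Rightarrow> real" where
  "rhs_f a b \<alpha> \<xi> F N u x k = - (1 / \<xi>) * deriv (\<lambda>s. Eh a b \<alpha> F N (u(k := s)) x) (u k)"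

definition rhs_g ::
  "real \<Rightarrow> real \<Rightarrow> real \<Rightarrow> real \<Rightarrow> (real \<Rightarrow> real \<Rightarrow> real) \<Rightarrow> nat \<Rightarrow>
   (nat \<Rightarrow> real) \<Rightarrow> (nat \<Rightarrow> real) \<Rightarrow> nat \<Rightarrow> real" where
  "rhs_g a b \<alpha> \<xi> F N u x k = - (1 / \<xi>) * deriv (\<lambda>s. Eh a b \<alpha> F N u (x(k := s))) (x k)"

end

(*
  Along a solution the energy is differentiated by the chain rule, and the ODE system turns the
  result into -xi times the quadratic form of the system matrix in (u', x').  Off the nodes
  beta_k = -(u_h)' phi_k, so this form is the integral of
  (sum_k (u'_k - (u_h)' x'_k) phi_k)^2 plus delta |x'|^2.  It is nonnegative, and if it vanishes
  then x' = 0, hence sum_k u'_k phi_k = 0, hence u' = 0.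

  The chain rule needs care because f(., u_h) is not assumed integrable up to the end points of
  the interval; it is only integrable against functions of H10.  Let G(z, .) be the hat function
  with its only interior kink at z (the Green function of -d^2/dy^2 with zero boundary values).
  Then u_h = sum_j D_j (G(x_{j+1}, .) - G(x_j, .)) with the elementwise slopes D_j, and the
  difference quotients of G in z are dominated by a multiple of (y - a)(b - y), which lies in H10.
  So z |-> int g G(z, .) is differentiable for every such g; applied to g = f(., u_h) at a fixed
  time this gives the linear part of the potential energy, and the Lipschitz bound on f makes the
  remainder quadratic.
*)

theory Submission
  imports Defs
begin

section \<open>Differentiability in nodal values and node positions\<close>

text \<open>
  The type \<open>nat \<Rightarrow> real\<close> is not a normed space, so differentiability is expressed in the sense
  of Hadamard: the chain rule holds along every differentiable curve through \<open>(u0, x0)\<close>.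
  The existence version \<open>has_some_gradient\<close> is all that is needed, because \<open>rhs_f\<close> and \<open>rhs_g\<close>
  are themselves defined by partial derivatives.
\<close>

definition has_gradient ::
  "nat \<Rightarrow> ((nat \<Rightarrow> real) \<Rightarrow> (nat \<Rightarrow> real) \<Rightarrow> real) \<Rightarrow> (nat \<Rightarrow> real) \<Rightarrow> (nat \<Rightarrow> real) \<Rightarrow>
   (nat \<Rightarrow> real) \<Rightarrow> (nat \<Rightarrow> real) \<Rightarrow> bool" where
  "has_gradient N E u0 x0 p q \<longleftrightarrow>
     (\<forall>u x u' x' t T. u t = u0 \<longrightarrow> x t = x0 \<longrightarrow>
        (\<forall>k\<in>{1..N - 1}. ((\<lambda>s. u s k) has_real_derivative u' k) (at t within T)) \<longrightarrow>
        (\<forall>k\<in>{1..N - 1}. ((\<lambda>s. x s k) has_real_derivative x' k) (at t within T)) \<longrightarrow>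
        ((\<lambda>s. E (u s) (x s)) has_real_derivative
           (\<Sum>k = 1..N - 1. p k * u' k + q k * x' k)) (at t within T))"

definition has_some_gradient where
  "has_some_gradient N E u0 x0 \<longleftrightarrow> (\<exists>p q. has_gradient N E u0 x0 p q)"

lemma has_gradientI:
  assumes "\<And>u x u' x' t T.
      \<lbrakk>u t = u0; x t = x0;
       \<And>k. k \<in> {1..N - 1} \<Longrightarrow> ((\<lambda>s. u s k) has_real_derivative u' k) (at t within T);
       \<And>k. k \<in> {1..N - 1} \<Longrightarrow> ((\<lambda>s. x s k) has_real_derivative x' k) (at t within T)\<rbrakk> \<Longrightarrow>
      ((\<lambda>s. E (u s) (x s)) has_real_derivative
           (\<Sum>k = 1..N - 1. p k * u' k + q k * x' k)) (at t within T)"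
  shows "has_gradient N E u0 x0 p q"
  unfolding has_gradient_def using assms by blast

lemma has_gradientD:
  assumes "has_gradient N E (u t) (x t) p q"
    and "\<And>k. k \<in> {1..N - 1} \<Longrightarrow> ((\<lambda>s. u s k) has_real_derivative u' k) (at t within T)"
    and "\<And>k. k \<in> {1..N - 1} \<Longrightarrow> ((\<lambda>s. x s k) has_real_derivative x' k) (at t within T)"
  shows "((\<lambda>s. E (u s) (x s)) has_real_derivative
           (\<Sum>k = 1..N - 1. p k * u' k + q k * x' k)) (at t within T)"
  using assms unfolding has_gradient_def by blast

lemma has_gradient_const: "has_gradient N (\<lambda>u x. c) u0 x0 (\<lambda>_. 0) (\<lambda>_. 0)"
  by (rule has_gradientI) simp

lemma has_gradient_compose:
  assumes E: "has_gradient N E u0 x0 p q" and h: "(h has_real_derivative d) (at (E u0 x0))"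
  shows "has_gradient N (\<lambda>u x. h (E u x)) u0 x0 (\<lambda>k. d * p k) (\<lambda>k. d * q k)"
proof (rule has_gradientI)
  fix u x :: "real \<Rightarrow> nat \<Rightarrow> real" and u' x' t T
  assume A: "u t = u0" "x t = x0"
       "\<And>k. k \<in> {1..N - 1} \<Longrightarrow> ((\<lambda>s. u s k) has_real_derivative u' k) (at t within T)"
       "\<And>k. k \<in> {1..N - 1} \<Longrightarrow> ((\<lambda>s. x s k) has_real_derivative x' k) (at t within T)"
  have "((\<lambda>s. E (u s) (x s)) has_real_derivative
           (\<Sum>k = 1..N - 1. p k * u' k + q k * x' k)) (at t within T)"
    by (rule has_gradientD) (use E A in auto)
  from DERIV_chain2[OF _ this, of h d] h A(1,2)
  show "((\<lambda>s. h (E (u s) (x s))) has_real_derivative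
          (\<Sum>k = 1..N - 1. d * p k * u' k + d * q k * x' k)) (at t within T)"
    by (simp add: sum_distrib_left algebra_simps)
qed

lemma has_gradient_add:
  assumes "has_gradient N E1 u0 x0 p1 q1" "has_gradient N E2 u0 x0 p2 q2"
  shows "has_gradient N (\<lambda>u x. E1 u x + E2 u x) u0 x0 (\<lambda>k. p1 k + p2 k) (\<lambda>k. q1 k + q2 k)"
proof (rule has_gradientI)
  fix u x :: "real \<Rightarrow> nat \<Rightarrow> real" and u' x' t T
  assume A: "u t = u0" "x t = x0"
       "\<And>k. k \<in> {1..N - 1} \<Longrightarrow> ((\<lambda>s. u s k) has_real_derivative u' k) (at t within T)"
       "\<And>k. k \<in> {1..N - 1} \<Longrightarrow> ((\<lambda>s. x s k) has_real_derivative x' k) (at t within T)"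
  from assms A show "((\<lambda>s. E1 (u s) (x s) + E2 (u s) (x s)) has_real_derivative
      (\<Sum>k = 1..N - 1. (p1 k + p2 k) * u' k + (q1 k + q2 k) * x' k)) (at t within T)"
    using DERIV_add[OF has_gradientD[of N E1 u t x p1 q1 u' T x'] has_gradientD[of N E2 u t x p2 q2 u' T x']]
    by (simp add: sum.distrib algebra_simps)
qed

lemma has_gradient_mult:
  assumes "has_gradient N E1 u0 x0 p1 q1" "has_gradient N E2 u0 x0 p2 q2"
  shows "has_gradient N (\<lambda>u x. E1 u x * E2 u x) u0 x0
           (\<lambda>k. p1 k * E2 u0 x0 + p2 k * E1 u0 x0) (\<lambda>k. q1 k * E2 u0 x0 + q2 k * E1 u0 x0)"
proof (rule has_gradientI)
  fix u x :: "real \<Rightarrow> nat \<Rightarrow> real" and u' x' t T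
  assume A: "u t = u0" "x t = x0"
       "\<And>k. k \<in> {1..N - 1} \<Longrightarrow> ((\<lambda>s. u s k) has_real_derivative u' k) (at t within T)"
       "\<And>k. k \<in> {1..N - 1} \<Longrightarrow> ((\<lambda>s. x s k) has_real_derivative x' k) (at t within T)"
  have 1: "((\<lambda>s. E1 (u s) (x s) * E2 (u s) (x s)) has_real_derivative
      (\<Sum>k = 1..N - 1. p1 k * u' k + q1 k * x' k) * E2 u0 x0
      + (\<Sum>k = 1..N - 1. p2 k * u' k + q2 k * x' k) * E1 u0 x0) (at t within T)"
    using DERIV_mult[OF has_gradientD[of N E1 u t x p1 q1 u' T x'] has_gradientD[of N E2 u t x p2 q2 u' T x']]
      assms A by simp
  have 2: "(\<Sum>k = 1..N - 1. p1 k * u' k + q1 k * x' k) * E2 u0 x0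
      + (\<Sum>k = 1..N - 1. p2 k * u' k + q2 k * x' k) * E1 u0 x0
     = (\<Sum>k = 1..N - 1. (p1 k * E2 u0 x0 + p2 k * E1 u0 x0) * u' k +
            (q1 k * E2 u0 x0 + q2 k * E1 u0 x0) * x' k)"
    unfolding sum_distrib_right sum.distrib[symmetric]
    by (rule sum.cong) (auto simp: algebra_simps)
  show "((\<lambda>s. E1 (u s) (x s) * E2 (u s) (x s)) has_real_derivative
      (\<Sum>k = 1..N - 1. (p1 k * E2 u0 x0 + p2 k * E1 u0 x0) * u' k +
            (q1 k * E2 u0 x0 + q2 k * E1 u0 x0) * x' k)) (at t within T)"
    using 1 unfolding 2 .
qed

section \<open>Coordinate functions and the calculus rules for gradients\<close>

lemma has_gradient_u: "k \<in> {1..N - 1} \<Longrightarrow>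
    has_gradient N (\<lambda>u x. u k) u0 x0 (\<lambda>j. of_bool (j = k)) (\<lambda>_. 0)"
  by (rule has_gradientI) (simp add: of_bool_def if_distrib[where f="\<lambda>c. c * _"] cong: if_cong)

lemma has_gradient_x: "k \<in> {1..N - 1} \<Longrightarrow>
    has_gradient N (\<lambda>u x. x k) u0 x0 (\<lambda>_. 0) (\<lambda>j. of_bool (j = k))"
  by (rule has_gradientI) (simp add: of_bool_def if_distrib[where f="\<lambda>c. c * _"] cong: if_cong)

named_theorems gradient_intros

lemma has_some_gradient_const [gradient_intros]: "has_some_gradient N (\<lambda>u x. c) u0 x0"
  unfolding has_some_gradient_def using has_gradient_const by blast

lemma has_some_gradient_add [gradient_intros]:
  "has_some_gradient N E1 u0 x0 \<Longrightarrow> has_some_gradient N E2 u0 x0 \<Longrightarrow>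
   has_some_gradient N (\<lambda>u x. E1 u x + E2 u x) u0 x0"
  unfolding has_some_gradient_def using has_gradient_add by blast

lemma has_some_gradient_mult [gradient_intros]:
  "has_some_gradient N E1 u0 x0 \<Longrightarrow> has_some_gradient N E2 u0 x0 \<Longrightarrow>
   has_some_gradient N (\<lambda>u x. E1 u x * E2 u x) u0 x0"
  unfolding has_some_gradient_def using has_gradient_mult by blast

lemma has_some_gradient_compose:
  "has_some_gradient N E u0 x0 \<Longrightarrow> (h has_real_derivative d) (at (E u0 x0)) \<Longrightarrow>
   has_some_gradient N (\<lambda>u x. h (E u x)) u0 x0"
  unfolding has_some_gradient_def using has_gradient_compose by blast

lemma has_some_gradient_diff [gradient_intros]:
  assumes "has_some_gradient N E1 u0 x0" "has_some_gradient N E2 u0 x0"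
  shows "has_some_gradient N (\<lambda>u x. E1 u x - E2 u x) u0 x0"
proof -
  have "has_some_gradient N (\<lambda>u x. E1 u x + (- 1) * E2 u x) u0 x0"
    by (intro gradient_intros assms)
  then show ?thesis by simp
qed

lemma has_some_gradient_divide [gradient_intros]:
  assumes "has_some_gradient N E1 u0 x0" "has_some_gradient N E2 u0 x0" "E2 u0 x0 \<noteq> 0"
  shows "has_some_gradient N (\<lambda>u x. E1 u x / E2 u x) u0 x0"
proof -
  have "has_some_gradient N (\<lambda>u x. E1 u x * inverse (E2 u x)) u0 x0"
    by (intro gradient_intros assms has_some_gradient_compose[of N E2, OF _ DERIV_inverse])
  then show ?thesis by (simp add: divide_inverse)
qed

lemma has_some_gradient_sum [gradient_intros]:
  "(\<And>i. i \<in> A \<Longrightarrow> has_some_gradient N (E i) u0 x0) \<Longrightarrow>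
   has_some_gradient N (\<lambda>u x. \<Sum>i\<in>A. E i u x) u0 x0"
  by (induction A rule: infinite_finite_induct) (auto intro!: gradient_intros)

text \<open>Only the indices 1 to N - 1 are unknowns. At 0 and N the entry is fixed boundary data,
  hence the split into a coordinate function and a constant.\<close>

lemma has_some_gradient_vals [gradient_intros]:
  assumes "k \<le> N"
  shows "has_some_gradient N (\<lambda>u x. vals N u k) u0 x0"
proof (cases "k \<in> {1..N - 1}")
  case True
  then have "(\<lambda>u (x :: nat \<Rightarrow> real). vals N u k) = (\<lambda>u x. u k)"
    by (auto simp: vals_def fun_eq_iff)
  then show ?thesis
    unfolding has_some_gradient_def by simp (use has_gradient_u[OF True] in blast)
next
  case False
  then have "(\<lambda>u (x :: nat \<Rightarrow> real). vals N u k) = (\<lambda>u x. 0)"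
    using assms by (auto simp: vals_def fun_eq_iff)
  then show ?thesis
    by (simp add: has_some_gradient_const)
qed

lemma has_some_gradient_nodes [gradient_intros]:
  assumes "k \<le> N"
  shows "has_some_gradient N (\<lambda>u x. nodes a b N x k) u0 x0"
proof (cases "k \<in> {1..N - 1}")
  case True
  then have "(\<lambda>(u :: nat \<Rightarrow> real) x. nodes a b N x k) = (\<lambda>u x. x k)"
    by (auto simp: nodes_def fun_eq_iff)
  then show ?thesis
    unfolding has_some_gradient_def by simp (use has_gradient_x[OF True] in blast)
next
  case False
  then have "(\<lambda>(u :: nat \<Rightarrow> real) x. nodes a b N x k) = (\<lambda>u x. if k = 0 then a else b)"
    using assms by (auto simp: nodes_def fun_eq_iff)
  then show ?thesis
    by (simp add: has_some_gradient_const)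
qed

text \<open>The outer function \<open>r -> (r - c)^2\<close> has derivative 0 at
  \<open>c = E u0 x0\<close>, so the chain rule kills the gradient. Sums of such squares later
  majorize the Taylor remainder of the potential.\<close>

lemma has_gradient_square_diff:
  assumes "has_some_gradient N E u0 x0"
  shows "has_gradient N (\<lambda>u x. (E u x - E u0 x0)\<^sup>2) u0 x0 (\<lambda>_. 0) (\<lambda>_. 0)"
proof -
  obtain p q where "has_gradient N E u0 x0 p q"
    using assms by (auto simp: has_some_gradient_def)
  then have "has_gradient N (\<lambda>u x. (\<lambda>r. (r - E u0 x0)\<^sup>2) (E u x)) u0 x0 (\<lambda>k. 0 * p k) (\<lambda>k. 0 * q k)"
    by (rule has_gradient_compose) (auto intro!: derivative_eq_intros)
  then show ?thesis by simp
qed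

lemma has_gradient_zero_sum:
  "(\<And>i. i \<in> A \<Longrightarrow> has_gradient N (E i) u0 x0 (\<lambda>_. 0) (\<lambda>_. 0)) \<Longrightarrow>
   has_gradient N (\<lambda>u x. \<Sum>i\<in>A. E i u x) u0 x0 (\<lambda>_. 0) (\<lambda>_. 0)"
proof (induction A rule: infinite_finite_induct)
  case (insert i A)
  then have "has_gradient N (\<lambda>u x. E i u x + (\<Sum>i\<in>A. E i u x)) u0 x0 (\<lambda>_. 0 + 0) (\<lambda>_. 0 + 0)"
    by (intro has_gradient_add) auto
  with insert show ?case by simp
qed (auto intro: has_gradient_const)

section \<open>Openness of the mesh condition and squeezing of remainders\<close>

definition mesh :: "real \<Rightarrow> real \<Rightarrow> nat \<Rightarrow> (nat \<Rightarrow> real) \<Rightarrow> bool" where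
  "mesh a b N x \<longleftrightarrow> (\<forall>k<N. nodes a b N x k < nodes a b N x (k + 1))"

text \<open>The mesh condition is a finite conjunction of strict inequalities between quantities
  that are continuous along the curve. It includes \<open>a < x 1\<close> and
  \<open>x (N - 1) < b\<close> through the fixed end nodes.\<close>

lemma eventually_mesh:
  fixes x :: "real \<Rightarrow> nat \<Rightarrow> real"
  assumes "mesh a b N (x t)"
    and "\<And>k. k \<in> {1..N - 1} \<Longrightarrow> ((\<lambda>s. x s k) has_real_derivative x' k) (at t within T)"
  shows "eventually (\<lambda>s. mesh a b N (x s)) (at t within T)"
proof -
  have lim: "((\<lambda>s. nodes a b N (x s) k) \<longlongrightarrow> nodes a b N (x t) k) (at t within T)" if "k \<le> N" for k
  proof (cases "k \<in> {1..N - 1}")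
    case True
    then show ?thesis
      using assms(2)[OF True] DERIV_continuous unfolding continuous_within
      by (fastforce simp: nodes_def)
  next
    case False
    then show ?thesis using that by (auto simp: nodes_def)
  qed
  have "eventually (\<lambda>s. \<forall>k\<in>{..<N}. 0 < nodes a b N (x s) (k + 1) - nodes a b N (x s) k) (at t within T)"
  proof (intro eventually_ball_finite ballI)
    fix k assume "k \<in> {..<N}"
    then show "eventually (\<lambda>s. 0 < nodes a b N (x s) (k + 1) - nodes a b N (x s) k) (at t within T)"
      using assms(1)
      by (intro order_tendstoD(1)[OF tendsto_diff[OF lim lim]]) (auto simp: mesh_def)
  qed simp
  then show ?thesis by eventually_elim (simp add: mesh_def)
qed

text \<open>Closed formulas for the energy hold only for ordered nodes. The curve stays among the
  meshes near \<open>t\<close>, so agreement on meshes is enough to transfer a derivative.\<close>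

lemma has_some_gradient_mesh_cong:
  assumes "has_some_gradient N E1 u0 x0" and x0: "mesh a b N x0"
    and eq: "\<And>u x. mesh a b N x \<Longrightarrow> E1 u x = E2 u x"
  shows "has_some_gradient N E2 u0 x0"
proof -
  obtain p q where E1: "has_gradient N E1 u0 x0 p q"
    using assms by (auto simp: has_some_gradient_def)
  have "has_gradient N E2 u0 x0 p q"
  proof (rule has_gradientI)
    fix u x :: "real \<Rightarrow> nat \<Rightarrow> real" and u' x' t T
    assume A: "u t = u0" "x t = x0"
         "\<And>k. k \<in> {1..N - 1} \<Longrightarrow> ((\<lambda>s. u s k) has_real_derivative u' k) (at t within T)"
         "\<And>k. k \<in> {1..N - 1} \<Longrightarrow> ((\<lambda>s. x s k) has_real_derivative x' k) (at t within T)"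
    have 1: "((\<lambda>s. E1 (u s) (x s)) has_real_derivative
             (\<Sum>k = 1..N - 1. p k * u' k + q k * x' k)) (at t within T)"
      by (rule has_gradientD) (use E1 A in auto)
    have "eventually (\<lambda>s. E1 (u s) (x s) = E2 (u s) (x s)) (at t within T)"
      using eventually_mesh[of a b N x t x' T] A x0 by (auto elim!: eventually_mono intro: eq)
    then show "((\<lambda>s. E2 (u s) (x s)) has_real_derivative
             (\<Sum>k = 1..N - 1. p k * u' k + q k * x' k)) (at t within T)"
      using has_field_derivative_cong_eventually[of "\<lambda>s. E1 (u s) (x s)" "\<lambda>s. E2 (u s) (x s)"]
        1 eq[of "x t" "u t"] x0 A by auto
  qed
  then show ?thesis by (auto simp: has_some_gradient_def)
qed

text \<open>Both functions vanish at \<open>t\<close>, so the difference quotient of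
  \<open>R\<close> is bounded in absolute value by that of \<open>Q\<close>, which tends to
  0.\<close>

lemma has_derivative_zero_squeeze:
  fixes R Q :: "real \<Rightarrow> real"
  assumes Q: "(Q has_real_derivative 0) (at t within T)" "Q t = 0"
    and R: "R t = 0" "eventually (\<lambda>s. \<bar>R s\<bar> \<le> Q s) (at t within T)"
  shows "(R has_real_derivative 0) (at t within T)"
proof -
  have "((\<lambda>s. (Q s - Q t) / (s - t)) \<longlongrightarrow> 0) (at t within T)"
    using Q(1) by (simp add: has_field_derivative_iff)
  moreover have "eventually (\<lambda>s. norm ((R s - R t) / (s - t)) \<le> norm ((Q s - Q t) / (s - t)) * 1)
      (at t within T)"
    using R(2) by eventually_elim (use Q R(1) in \<open>auto simp: divide_simps abs_mult\<close>)
  ultimately show ?thesis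
    unfolding has_field_derivative_iff by (rule tendsto_0_le)
qed

lemma has_gradient_squeeze:
  assumes Q: "has_gradient N Q u0 x0 (\<lambda>_. 0) (\<lambda>_. 0)" "Q u0 x0 = 0" and x0: "mesh a b N x0"
    and R: "R u0 x0 = 0" "\<And>u x. mesh a b N x \<Longrightarrow> \<bar>R u x\<bar> \<le> Q u x"
  shows "has_gradient N R u0 x0 (\<lambda>_. 0) (\<lambda>_. 0)"
proof (rule has_gradientI)
  fix u x :: "real \<Rightarrow> nat \<Rightarrow> real" and u' x' t T
  assume A: "u t = u0" "x t = x0"
       "\<And>k. k \<in> {1..N - 1} \<Longrightarrow> ((\<lambda>s. u s k) has_real_derivative u' k) (at t within T)"
       "\<And>k. k \<in> {1..N - 1} \<Longrightarrow> ((\<lambda>s. x s k) has_real_derivative x' k) (at t within T)"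
  have 1: "((\<lambda>s. Q (u s) (x s)) has_real_derivative 0) (at t within T)"
    using has_gradientD[of N Q u t x "\<lambda>_. 0" "\<lambda>_. 0" u' T x'] Q A by simp
  have "eventually (\<lambda>s. \<bar>R (u s) (x s)\<bar> \<le> Q (u s) (x s)) (at t within T)"
    using eventually_mesh[of a b N x t x' T] A x0 by (auto elim!: eventually_mono intro: R)
  then show "((\<lambda>s. R (u s) (x s)) has_real_derivative
         (\<Sum>k = 1..N - 1. 0 * u' k + 0 * x' k)) (at t within T)"
    using has_derivative_zero_squeeze[OF 1, of "\<lambda>s. R (u s) (x s)"] Q(2) R(1) A by simp
qed

text \<open>Coordinate lines through \<open>(u0, x0)\<close> are admissible curves. This identifies
  the coefficients with the partial derivatives by which \<open>rhs_f\<close> and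
  \<open>rhs_g\<close> are defined.\<close>

lemma has_gradient_partials:
  assumes "has_gradient N E u0 x0 p q" "k \<in> {1..N - 1}"
  shows "deriv (\<lambda>s. E (u0(k := s)) x0) (u0 k) = p k"
    and "deriv (\<lambda>s. E u0 (x0(k := s))) (x0 k) = q k"
proof -
  have d: "((\<lambda>s. (v(k := s)) j) has_real_derivative of_bool (j = k)) (at t)" for v :: "nat \<Rightarrow> real" and t j
    by (cases "j = k") auto
  have "((\<lambda>s. E (u0(k := s)) x0) has_real_derivative
      (\<Sum>j = 1..N - 1. p j * of_bool (j = k) + q j * 0)) (at (u0 k))"
    by (rule has_gradientD[of N E "\<lambda>s. u0(k := s)" "u0 k" "\<lambda>s. x0"]) (use assms(1) d in auto)
  then show "deriv (\<lambda>s. E (u0(k := s)) x0) (u0 k) = p k"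
    using assms(2) by (simp add: DERIV_imp_deriv of_bool_def if_distrib[where f="\<lambda>c. _ * c"] cong: if_cong)
  have "((\<lambda>s. E u0 (x0(k := s))) has_real_derivative
      (\<Sum>j = 1..N - 1. p j * 0 + q j * of_bool (j = k))) (at (x0 k))"
    by (rule has_gradientD[of N E "\<lambda>s. u0" "x0 k" "\<lambda>s. x0(k := s)"]) (use assms(1) d in auto)
  then show "deriv (\<lambda>s. E u0 (x0(k := s))) (x0 k) = q k"
    using assms(2) by (simp add: DERIV_imp_deriv of_bool_def if_distrib[where f="\<lambda>c. _ * c"] cong: if_cong)
qed

section \<open>Piecewise linear functions on a mesh\<close>

lemma nodes_0 [simp]: "nodes a b N x 0 = a"
  by (simp add: nodes_def)

lemma nodes_N [simp]: "0 < N \<Longrightarrow> nodes a b N x N = b"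
  by (simp add: nodes_def)

lemma mesh_less:
  assumes "mesh a b N x" "i < j" "j \<le> N"
  shows "nodes a b N x i < nodes a b N x j"
  using assms(2,3)
proof (induction j)
  case (Suc j)
  have "nodes a b N x j < nodes a b N x (Suc j)"
    using assms(1) Suc.prems by (simp add: mesh_def)
  with Suc show ?case by (cases "i = j") force+
qed simp

lemma mesh_le:
  assumes "mesh a b N x" "i \<le> j" "j \<le> N"
  shows "nodes a b N x i \<le> nodes a b N x j"
  using mesh_less[OF assms(1), of i j] assms by (cases "i = j") auto

lemma mesh_nodes_bounds:
  assumes "mesh a b N x" "0 < N" "k \<le> N"
  shows "a \<le> nodes a b N x k" "nodes a b N x k \<le> b"
  using mesh_le[OF assms(1), of 0 k] mesh_le[OF assms(1), of k N] assms by auto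

lemma mesh_interior_nodes:
  assumes "mesh a b N x" "k \<in> {1..N - 1}"
  shows "nodes a b N x k \<in> {a<..<b}"
  using mesh_less[OF assms(1), of 0 k] mesh_less[OF assms(1), of k N] assms(2) by auto

lemma mesh_element_exists:
  assumes "mesh a b N x" "0 < N" "y \<in> {a<..<b}" "y \<notin> nodes a b N x ` {..N}"
  shows "\<exists>k<N. y \<in> {nodes a b N x k<..<nodes a b N x (k + 1)}"
proof -
  \<comment> \<open>The first node to the right of \<open>y\<close>. It is not node 0, which is
    \<open>a\<close>, so an element ends there, and minimality puts \<open>y\<close> into that
    element.\<close>
  define j where "j = (LEAST j. y < nodes a b N x j)"
  have ex: "y < nodes a b N x N" using assms by simp
  have j: "y < nodes a b N x j" "j \<le> N"
    unfolding j_def using LeastI[of "\<lambda>j. y < nodes a b N x j", OF ex] Least_le[of "\<lambda>j. y < nodes a b N x j", OF ex]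
    by auto
  have "j \<noteq> 0" using j assms by (intro notI) auto
  then obtain k where k: "j = Suc k" by (cases j) auto
  have "\<not> y < nodes a b N x k"
    using not_less_Least[of k "\<lambda>j. y < nodes a b N x j"] k unfolding j_def by simp
  moreover have "y \<noteq> nodes a b N x k" using assms(4) j k by auto
  ultimately show ?thesis using j k by (intro exI[of _ k]) auto
qed

lemma mesh_element_unique:
  assumes "mesh a b N x" "i < N" "j < N"
    "y \<in> {nodes a b N x i<..<nodes a b N x (i + 1)}" "y \<in> {nodes a b N x j<..<nodes a b N x (j + 1)}"
  shows "i = j"
proof (rule ccontr)
  assume "i \<noteq> j"
  then consider "i + 1 \<le> j" | "j + 1 \<le> i" by linarith
  then show False
    using mesh_le[OF assms(1), of "i + 1" j] mesh_le[OF assms(1), of "j + 1" i] assms by cases auto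
qed

section \<open>Elementwise slopes, and the ramp and Green representations of the discrete
  function\<close>

definition slope :: "real \<Rightarrow> real \<Rightarrow> nat \<Rightarrow> (nat \<Rightarrow> real) \<Rightarrow> (nat \<Rightarrow> real) \<Rightarrow> real \<Rightarrow> real" where
  "slope a b N u x y = (\<Sum>j<N. Dh (vals N u) (nodes a b N x) j *
     indicator {nodes a b N x j<..<nodes a b N x (j + 1)} y)"

lemma mesh_indicator:
  assumes "mesh a b N x" "i < N" "j < N" "y \<in> {nodes a b N x i<..<nodes a b N x (i + 1)}"
  shows "indicator {nodes a b N x j<..<nodes a b N x (j + 1)} y = (of_bool (j = i) :: real)"
proof (cases "j = i")
  case False
  then have "y \<notin> {nodes a b N x j<..<nodes a b N x (j + 1)}"
    using mesh_element_unique[OF assms(1-4)] by metis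
  with False show ?thesis by simp
qed (use assms(4) in simp)

lemma mesh_sum_indicator:
  assumes "mesh a b N x" "i < N" "y \<in> {nodes a b N x i<..<nodes a b N x (i + 1)}"
  shows "(\<Sum>j<N. c j * indicator {nodes a b N x j<..<nodes a b N x (j + 1)} y) = (c i :: real)"
proof -
  have "(\<Sum>j<N. c j * indicator {nodes a b N x j<..<nodes a b N x (j + 1)} y) =
      (\<Sum>j<N. if j = i then c j else 0)"
    using mesh_indicator[OF assms(1,2) _ assms(3)] by (intro sum.cong) auto
  then show ?thesis using assms(2) by simp
qed

text \<open>Each flank of the hat is a scaled difference of two ramps \<open>max 0 (y - z)\<close>.
  Unlike the form with indicators, this one is visibly continuous.\<close>

lemma hat_eq_max:
  assumes "X (k - 1) < X k" "X k < X (k + 1)"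
  shows "hat X k y = (max 0 (y - X (k - 1)) - max 0 (y - X k)) / (X k - X (k - 1))
    - (max 0 (y - X k) - max 0 (y - X (k + 1))) / (X (k + 1) - X k)"
proof -
  consider "y \<le> X (k - 1)" | "X (k - 1) < y" "y \<le> X k" | "X k < y" "y < X (k + 1)" | "X (k + 1) \<le> y"
    by linarith
  then show ?thesis
    by cases (use assms in \<open>auto simp: hat_def indicator_def field_simps\<close>)
qed

text \<open>Summation by parts. The ramp \<open>P j\<close> rises from 0 to 1 across element
  \<open>j\<close>, and the hat at node \<open>k\<close> is \<open>P (k - 1) - P k\<close>.
  Collecting the coefficient of each \<open>P j\<close> leaves increments of nodal values, which
  become slopes.\<close>

lemma uh_eq_max:
  assumes m: "mesh a b N x" and N: "2 \<le> N"
  shows "uh a b N u x y = (\<Sum>j<N. Dh (vals N u) (nodes a b N x) j *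
    (max 0 (y - nodes a b N x j) - max 0 (y - nodes a b N x (j + 1))))"
proof -
  define X where "X = nodes a b N x"
  define U where "U = vals N u"
  define P where "P j = (max 0 (y - X j) - max 0 (y - X (j + 1))) / (X (j + 1) - X j)" for j
  obtain M where M: "N = Suc M" using N by (cases N) auto
  have "uh a b N u x y = (\<Sum>k = 1..M. U k * (P (k - 1) - P k))"
    unfolding uh_def P_def X_def U_def
  proof (rule sum.cong, goal_cases)
    case (2 k)
    then show ?case
      using hat_eq_max[of "nodes a b N x" k y] mesh_less[OF m, of "k - 1" k] mesh_less[OF m, of k "k + 1"]
      by (simp add: vals_def M)
  qed (simp add: M)
  also have "\<dots> = (\<Sum>j<M. U (Suc j) * P j) - (\<Sum>j<M. U (Suc j) * P (Suc j))"
    by (simp add: sum.atLeast1_atMost_eq sum_subtractf algebra_simps)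
  \<comment> \<open>The boundary values \<open>U 0 = U N = 0\<close> allow both sums to run over all
    elements.\<close>
  also have "\<dots> = (\<Sum>j<N. U (Suc j) * P j) - (\<Sum>j<N. U j * P j)"
    unfolding M sum.lessThan_Suc_shift[of "\<lambda>j. U j * P j"] by (simp add: U_def vals_def M)
  also have "\<dots> = (\<Sum>j<N. (U (j + 1) - U j) * P j)"
    by (simp add: sum_subtractf algebra_simps)
  finally show ?thesis
    by (simp add: P_def X_def U_def Dh_def)
qed

text \<open>Slope times length is the increment of the nodal values, and the increments telescope to
  the difference of the two zero boundary values.\<close>

lemma sum_Dh_length:
  assumes m: "mesh a b N x"
  shows "(\<Sum>j<N. Dh (vals N u) (nodes a b N x) j * (nodes a b N x (j + 1) - nodes a b N x j)) = 0"
proof -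
  have "(\<Sum>j<N. Dh (vals N u) (nodes a b N x) j * (nodes a b N x (j + 1) - nodes a b N x j)) =
      (\<Sum>j<N. vals N u (Suc j) - vals N u j)"
    using m by (intro sum.cong) (auto simp: Dh_def mesh_def)
  also have "\<dots> = 0"
    unfolding sum_lessThan_telescope by (simp add: vals_def)
  finally show ?thesis .
qed

text \<open>The hat with its kink at \<open>z\<close>, written as a linear function minus one ramp.
  For \<open>a < b\<close> it vanishes on all of \<open>[a, b]\<close> when \<open>z = a\<close> or
  \<open>z = b\<close>.\<close>

definition green :: "real \<Rightarrow> real \<Rightarrow> real \<Rightarrow> real \<Rightarrow> real" where
  "green a b z y = (b - z) * (y - a) / (b - a) - max 0 (y - z)"

text \<open>Passing from ramps to Green functions changes the sum by a multiple of
  \<open>(y - a) / (b - a)\<close> whose coefficient is the vanishing total of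
  \<open>sum_Dh_length\<close>. The gain is that each Green function lies in \<open>H10\<close> and
  can be integrated against \<open>f(., v)\<close> separately.\<close>

lemma uh_eq_green:
  assumes m: "mesh a b N x" and N: "2 \<le> N"
  shows "uh a b N u x y = (\<Sum>j<N. Dh (vals N u) (nodes a b N x) j *
    (green a b (nodes a b N x (j + 1)) y - green a b (nodes a b N x j) y))"
proof -
  let ?X = "nodes a b N x" and ?D = "Dh (vals N u) (nodes a b N x)"
  have "?D j * (green a b (?X (j + 1)) y - green a b (?X j) y) =
      ?D j * (max 0 (y - ?X j) - max 0 (y - ?X (j + 1))) -
      ?D j * (?X (j + 1) - ?X j) * ((y - a) / (b - a))" for j
    by (simp add: green_def algebra_simps diff_divide_distrib add_divide_distrib)
  then have "(\<Sum>j<N. ?D j * (green a b (?X (j + 1)) y - green a b (?X j) y)) =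
      (\<Sum>j<N. ?D j * (max 0 (y - ?X j) - max 0 (y - ?X (j + 1)))) -
      (\<Sum>j<N. ?D j * (?X (j + 1) - ?X j)) * ((y - a) / (b - a))"
    by (simp only: sum_subtractf sum_distrib_right)
  then show ?thesis
    by (simp only: uh_eq_max[OF m N] sum_Dh_length[OF m] mult_zero_left diff_zero)
qed

lemma uh_has_derivative:
  assumes m: "mesh a b N x" and N: "2 \<le> N" and y: "y \<notin> nodes a b N x ` {..N}"
  shows "(uh a b N u x has_real_derivative slope a b N u x y) (at y)"
proof -
  let ?X = "nodes a b N x" and ?D = "Dh (vals N u) (nodes a b N x)"
  have 1: "((\<lambda>y. max 0 (y - z)) has_real_derivative indicator {z<..} y) (at y)" if "y \<noteq> z" for z :: real
  proof (cases "y < z")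
    case True
    have "((\<lambda>y. max 0 (y - z)) has_real_derivative 0) (at y)"
      by (rule has_field_derivative_transform_within_open[of "\<lambda>y. 0" _ _ "{..<z}"]) (use True in auto)
    with True show ?thesis by simp
  next
    case False
    have "((\<lambda>y. max 0 (y - z)) has_real_derivative 1) (at y)"
      by (rule has_field_derivative_transform_within_open[of "\<lambda>y. y - z" _ _ "{z<..}"])
         (use False that in \<open>auto intro!: derivative_eq_intros\<close>)
    with False that show ?thesis by simp
  qed
  have "((\<lambda>y. \<Sum>j<N. ?D j * (max 0 (y - ?X j) - max 0 (y - ?X (j + 1)))) has_real_derivative
      (\<Sum>j<N. ?D j * (indicator {?X j<..} y - indicator {?X (j + 1)<..} y))) (at y)"
    by (intro DERIV_sum DERIV_cmult DERIV_diff 1) (use y in auto)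
  \<comment> \<open>Off the nodes, the two half-line indicators differ by the indicator of the open
    element between them.\<close>
  also have "(\<Sum>j<N. ?D j * (indicator {?X j<..} y - indicator {?X (j + 1)<..} y)) = slope a b N u x y"
    unfolding slope_def
  proof (rule sum.cong, goal_cases)
    case (2 j)
    then have "y \<noteq> ?X j" "y \<noteq> ?X (j + 1)" "?X j < ?X (j + 1)"
      using y m by (auto simp: mesh_def)
    then show ?case by (auto simp: indicator_def)
  qed simp
  also have "(\<lambda>y. \<Sum>j<N. ?D j * (max 0 (y - ?X j) - max 0 (y - ?X (j + 1)))) = uh a b N u x"
    by (simp add: uh_eq_max[OF m N] fun_eq_iff)
  finally show ?thesis .
qed

text \<open>Off the nodes exactly one element indicator survives, and there \<open>beta\<close>
  carries the slope of that element as a factor. This makes the block matrix without the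
  \<open>\<delta>\<close> term a Gram matrix.\<close>

lemma beta_eq_slope_hat:
  assumes m: "mesh a b N x" and k: "k \<in> {1..N - 1}"
    and y: "y \<in> {a<..<b}" "y \<notin> nodes a b N x ` {..N}"
  shows "beta (vals N u) (nodes a b N x) k y = - slope a b N u x y * hat (nodes a b N x) k y"
proof -
  let ?X = "nodes a b N x"
  obtain i where i: "i < N" "y \<in> {?X i<..<?X (i + 1)}"
    using mesh_element_exists[OF m _ y] k by fastforce
  have s: "slope a b N u x y = Dh (vals N u) ?X i"
    unfolding slope_def by (rule mesh_sum_indicator[OF m i])
  have ne: "y \<noteq> ?X k" using y k by auto
  have km: "k - 1 < N" "k < N" "Suc (k - 1) = k" using k by auto
  \<comment> \<open>\<open>hat\<close> has a half-open left element and \<open>beta\<close> an open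
    one; they differ only at the node itself, which is excluded here.\<close>
  have "indicator {?X (k - 1)<..?X k} y = (indicator {?X (k - 1)<..<?X k} y :: real)"
    using ne by (auto simp: indicator_def)
  moreover have "indicator {?X (k - 1)<..<?X k} y = (of_bool (k - 1 = i) :: real)"
    using mesh_indicator[OF m i(1) km(1) i(2)] km by simp
  moreover have "indicator {?X k<..<?X (k + 1)} y = (of_bool (k = i) :: real)"
    using mesh_indicator[OF m i(1) km(2) i(2)] by simp
  ultimately show ?thesis
    unfolding beta_def hat_def s using km by (auto simp: algebra_simps diff_divide_distrib)
qed

lemma hat_bounds:
  assumes "X (k - 1) < X k" "X k < X (k + 1)"
  shows "0 \<le> hat X k y" "hat X k y \<le> 1"
  using assms by (auto simp: hat_def indicator_def)

lemma continuous_on_hat: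
  assumes "X (k - 1) < X k" "X k < X (k + 1)"
  shows "continuous_on S (hat X k)"
  unfolding hat_eq_max[of X k, OF assms, abs_def] using assms by (intro continuous_intros) auto

lemma uh_at_node:
  assumes m: "mesh a b N x" and k: "k \<in> {1..N - 1}"
  shows "uh a b N u x (nodes a b N x k) = u k"
proof -
  let ?X = "nodes a b N x"
  have "hat ?X j (?X k) = of_bool (j = k)" if j: "j \<in> {1..N - 1}" for j
  proof -
    have lt: "?X (j - 1) < ?X j" "?X j < ?X (j + 1)"
      using mesh_less[OF m, of "j - 1" j] mesh_less[OF m, of j "j + 1"] j by auto
    have le: "j - 1 \<le> N" "k \<le> N" using j k by auto
    consider "k \<le> j - 1" "k < j" | "j = k" | "j + 1 \<le> k" by linarith
    then show ?thesis
      using mesh_le[OF m _ le(1), of k] mesh_le[OF m _ le(2), of "j + 1"] lt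
      by cases (auto simp: hat_def indicator_def)
  qed
  then have "uh a b N u x (?X k) = (\<Sum>j = 1..N - 1. u j * of_bool (j = k))"
    unfolding uh_def by (intro sum.cong) auto
  then show ?thesis
    using k by (simp add: of_bool_def if_distrib[where f="\<lambda>c. _ * c"] cong: if_cong)
qed

section \<open>Membership in \<open>H10\<close>\<close>

lemma set_integral_cong_finite:
  fixes f g :: "real \<Rightarrow> real"
  assumes "finite S" "\<And>y. y \<in> A \<Longrightarrow> y \<notin> S \<Longrightarrow> f y = g y"
  shows "(LINT y:A|lebesgue. f y) = (LINT y:A|lebesgue. g y)"
  unfolding set_lebesgue_integral_def
  by (rule integral_discrete_difference[of S])
     (use assms in \<open>auto simp: indicator_def countable_finite\<close>)

lemma set_integrable_continuous_Ioo:
  fixes g :: "real \<Rightarrow> real"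
  assumes "continuous_on {a..b} g"
  shows "set_integrable lebesgue {a<..<b} g"
  by (rule set_integrable_subset[OF absolutely_integrable_continuous_real[OF assms]]) auto

lemma set_integrable_bounded_Ioo:
  fixes g :: "real \<Rightarrow> real"
  assumes "set_borel_measurable lebesgue {a<..<b} g" "\<And>y. y \<in> {a<..<b} \<Longrightarrow> \<bar>g y\<bar> \<le> M"
  shows "set_integrable lebesgue {a<..<b} g"
proof (rule set_integrable_bound[OF _ assms(1)])
  show "set_integrable lebesgue {a<..<b} (\<lambda>_. M)"
    by (rule set_integrable_continuous_Ioo) simp
  show "AE x in lebesgue. x \<in> {a<..<b} \<longrightarrow> norm (g x) \<le> norm M"
    using assms(2) by (fastforce intro!: AE_I2)
qed

lemma set_borel_measurable_mult:
  fixes f g :: "'a \<Rightarrow> real"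
  assumes "set_borel_measurable M A f" "set_borel_measurable M A g"
  shows "set_borel_measurable M A (\<lambda>y. f y * g y)"
proof -
  have "(\<lambda>y. indicator A y *\<^sub>R (f y * g y)) = (\<lambda>y. (indicator A y *\<^sub>R f y) * (indicator A y *\<^sub>R g y))"
    by (auto simp: indicator_def fun_eq_iff)
  then show ?thesis
    using assms unfolding set_borel_measurable_def by simp
qed

lemma set_integrable_imp_set_borel_measurable:
  "set_integrable M A f \<Longrightarrow> set_borel_measurable M A f"
  unfolding set_integrable_def set_borel_measurable_def by (rule borel_measurable_integrable)

lemma set_borel_measurable_lebesgueI:
  fixes g :: "real \<Rightarrow> real"
  shows "g \<in> borel_measurable borel \<Longrightarrow> A \<in> sets lebesgue \<Longrightarrow> set_borel_measurable lebesgue A g"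
  unfolding set_borel_measurable_def
  by (intro borel_measurable_scaleR borel_measurable_indicator) (auto intro: measurable_completion)

lemma set_integral_const_Ioo:
  fixes a b c :: real
  assumes "a \<le> b"
  shows "(LINT y:{a<..<b}|lebesgue. c) = c * (b - a)"
proof -
  have "(LINT y:{a<..<b}|lebesgue. c) = integral {a<..<b} (\<lambda>_. c)"
    by (rule set_lebesgue_integral_eq_integral(2)) (intro set_integrable_continuous_Ioo continuous_intros)
  then show ?thesis
    using assms by (simp add: integral_open_interval_real[symmetric])
qed

text \<open>Integration by parts: \<open>u * \<phi>\<close> is continuous and differentiable off the
  finite set \<open>S\<close>, so the fundamental theorem with exceptional points applies, and its
  boundary terms vanish with \<open>u\<close>. The bound on \<open>g\<close> gives square
  integrability.\<close>

lemma H10I: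
  assumes "a < b" and u: "continuous_on {a..b} u" "u a = 0" "u b = 0" and "finite S"
    and der: "\<And>y. y \<in> {a<..<b} - S \<Longrightarrow> (u has_real_derivative g y) (at y)"
    and g: "g \<in> borel_measurable borel" "\<And>y. y \<in> {a<..<b} \<Longrightarrow> \<bar>g y\<bar> \<le> M"
  shows "u \<in> H10 a b"
proof -
  have gm: "set_borel_measurable lebesgue {a<..<b} g"
    by (rule set_borel_measurable_lebesgueI) (use g in auto)
  have "set_integrable lebesgue {a<..<b} (\<lambda>y. (g y)\<^sup>2)"
  proof (rule set_integrable_bounded_Ioo)
    show "set_borel_measurable lebesgue {a<..<b} (\<lambda>y. (g y)\<^sup>2)"
      using set_borel_measurable_mult[OF gm gm] by (simp add: power2_eq_square)
    show "\<bar>(g y)\<^sup>2\<bar> \<le> M\<^sup>2" if "y \<in> {a<..<b}" for y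
      using g(2)[OF that] by (metis abs_ge_zero power_abs power_mono)
  qed
  with gm have sq_g: "sq_integrable a b g"
    by (simp add: sq_integrable_def)
  have "set_integrable lebesgue {a<..<b} u" "set_integrable lebesgue {a<..<b} (\<lambda>y. (u y)\<^sup>2)"
    by (intro set_integrable_continuous_Ioo continuous_intros u)+
  then have sq_u: "sq_integrable a b u"
    by (simp add: sq_integrable_def set_integrable_imp_set_borel_measurable)
  have "weak_derivative a b u g"
    unfolding weak_derivative_def
  proof (intro allI impI)
    fix \<phi> assume "test_function a b \<phi>"
    then have d: "(deriv ^^ n) \<phi> differentiable (at y)" for n y
      by (simp add: test_function_def)
    have d0: "(\<phi> has_real_derivative deriv \<phi> y) (at y)" for y
      using d[of 0 y] DERIV_deriv_iff_real_differentiable by auto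
    have c0: "continuous_on A \<phi>" for A
      using d0 DERIV_isCont by (blast intro: continuous_at_imp_continuous_on)
    have c1: "continuous_on A (deriv \<phi>)" for A
      using d[of 1] differentiable_imp_continuous_within
      by (fastforce intro: continuous_at_imp_continuous_on)
    have "((\<lambda>y. u y * deriv \<phi> y + g y * \<phi> y) has_integral u b * \<phi> b - u a * \<phi> a) {a..b}"
    proof (rule fundamental_theorem_of_calculus_interior_strong[OF \<open>finite S\<close>])
      fix y assume "y \<in> {a<..<b} - S"
      from DERIV_mult[OF der[OF this] d0]
      show "((\<lambda>y. u y * \<phi> y) has_vector_derivative u y * deriv \<phi> y + g y * \<phi> y) (at y)"
        by (simp add: has_real_derivative_iff_has_vector_derivative algebra_simps)
    qed (use \<open>a < b\<close> u in \<open>auto intro!: continuous_intros c0\<close>)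
    then have int0: "integral {a<..<b} (\<lambda>y. u y * deriv \<phi> y + g y * \<phi> y) = 0"
      using u by (simp add: integral_open_interval_real[symmetric] integral_unique)
    have i1: "set_integrable lebesgue {a<..<b} (\<lambda>y. u y * deriv \<phi> y)"
      by (intro set_integrable_continuous_Ioo continuous_intros u c1)
    have "bounded (\<phi> ` {a..b})"
      by (intro compact_imp_bounded compact_continuous_image c0) simp
    then obtain K where "\<forall>z\<in>\<phi> ` {a..b}. norm z \<le> K"
      unfolding bounded_iff by blast
    then have K: "\<And>y. y \<in> {a..b} \<Longrightarrow> \<bar>\<phi> y\<bar> \<le> K"
      by auto
    have i2: "set_integrable lebesgue {a<..<b} (\<lambda>y. g y * \<phi> y)"
    proof (rule set_integrable_bounded_Ioo)
      show "set_borel_measurable lebesgue {a<..<b} (\<lambda>y. g y * \<phi> y)"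
        by (intro set_borel_measurable_mult gm set_integrable_imp_set_borel_measurable
            set_integrable_continuous_Ioo c0)
      show "\<bar>g y * \<phi> y\<bar> \<le> M * K" if "y \<in> {a<..<b}" for y
        unfolding abs_mult using g(2)[OF that] K[of y] that by (intro mult_mono) auto
    qed
    have "(LINT y:{a<..<b}|lebesgue. u y * deriv \<phi> y) + (LINT y:{a<..<b}|lebesgue. g y * \<phi> y) =
        (LINT y:{a<..<b}|lebesgue. u y * deriv \<phi> y + g y * \<phi> y)"
      by (rule set_integral_add(2)[OF i1 i2, symmetric])
    also have "\<dots> = 0"
      using set_lebesgue_integral_eq_integral(2)[OF set_integral_add(1)[OF i1 i2]] int0 by simp
    finally show "(LINT y:{a<..<b}|lebesgue. u y * deriv \<phi> y) = - (LINT y:{a<..<b}|lebesgue. g y * \<phi> y)"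
      by simp
  qed
  with sq_u sq_g u show ?thesis
    by (auto simp: H10_def H1_def)
qed

lemma slope_borel_measurable [measurable]: "slope a b N u x \<in> borel_measurable borel"
  unfolding slope_def by measurable

lemma slope_bound: "\<bar>slope a b N u x y\<bar> \<le> (\<Sum>j<N. \<bar>Dh (vals N u) (nodes a b N x) j\<bar>)"
  unfolding slope_def by (rule order_trans[OF sum_abs]) (auto intro!: sum_mono simp: indicator_def)

lemma continuous_on_uh:
  assumes "mesh a b N x" "2 \<le> N"
  shows "continuous_on A (uh a b N u x)"
  unfolding uh_eq_max[OF assms, abs_def] by (intro continuous_intros)

lemma uh_in_H10:
  assumes m: "mesh a b N x" and N: "2 \<le> N"
  shows "uh a b N u x \<in> H10 a b"
proof (rule H10I[where S = "nodes a b N x ` {..N}"])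
  have z: "green a b z a = 0" "green a b z b = 0" if "a \<le> z" "z \<le> b" "a < b" for z
    using that by (auto simp: green_def)
  show ab: "a < b" using mesh_less[OF m, of 0 N] N by simp
  \<comment> \<open>Each Green function with kink in \<open>[a, b]\<close> vanishes at both end
    points, hence so does every summand.\<close>
  have "uh a b N u x a = 0 \<and> uh a b N u x b = 0"
    unfolding uh_eq_green[OF m N] using mesh_nodes_bounds[OF m] N ab
    by (auto intro!: sum.neutral simp: z)
  then show "uh a b N u x a = 0" "uh a b N u x b = 0" by auto
  show "(uh a b N u x has_real_derivative slope a b N u x y) (at y)"
    if "y \<in> {a<..<b} - nodes a b N x ` {..N}" for y
    using uh_has_derivative[OF m N] that by blast
qed (auto intro: continuous_on_uh[OF m N] slope_bound)

lemma green_in_H10: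
  assumes "a < b" "a \<le> z" "z \<le> b"
  shows "green a b z \<in> H10 a b"
proof (rule H10I[where S = "{z}" and M = "\<bar>(b - z) / (b - a)\<bar> + 1"
      and g = "\<lambda>y. (b - z) / (b - a) - indicator {z<..} y"])
  fix y assume y: "y \<in> {a<..<b} - {z}"
  show "(green a b z has_real_derivative (b - z) / (b - a) - indicator {z<..} y) (at y)"
  proof (cases "y < z")
    case True
    show ?thesis
      by (rule has_field_derivative_transform_within_open[of "\<lambda>y. (b - z) * (y - a) / (b - a)" _ _ "{..<z}"])
         (use True assms in \<open>auto simp: green_def intro!: derivative_eq_intros\<close>)
  next
    case False
    show ?thesis
      by (rule has_field_derivative_transform_within_open[of "\<lambda>y. (b - z) * (y - a) / (b - a) - (y - z)" _ _ "{z<..}"])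
         (use False y assms in \<open>auto simp: green_def intro!: derivative_eq_intros\<close>)
  qed
next
  show "continuous_on {a..b} (green a b z)"
    unfolding green_def using assms by (intro continuous_intros) auto
  show "\<bar>(b - z) / (b - a) - indicator {z<..} y\<bar> \<le> \<bar>(b - z) / (b - a)\<bar> + 1" for y
    using abs_triangle_ineq4[of "(b - z) / (b - a)" "indicator {z<..} y"]
    by (auto simp: indicator_def split: if_splits)
qed (use assms in \<open>auto simp: green_def\<close>)

text \<open>The parabola is the weight in \<open>green_lipschitz\<close>. Its membership in
  \<open>H10\<close> makes its product with \<open>g\<close> integrable, which yields the dominating
  function.\<close>

lemma parabola_in_H10:
  assumes "a < b"
  shows "(\<lambda>y. (y - a) * (b - y)) \<in> H10 a b"
proof (rule H10I[where S = "{}" and M = "2 * \<bar>a\<bar> + 2 * \<bar>b\<bar>" and g = "\<lambda>y. a + b - 2 * y"])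
  show "((\<lambda>y. (y - a) * (b - y)) has_real_derivative a + b - 2 * y) (at y)" for y
    by (auto intro!: derivative_eq_intros)
  show "\<bar>a + b - 2 * y\<bar> \<le> 2 * \<bar>a\<bar> + 2 * \<bar>b\<bar>" if "y \<in> {a<..<b}" for y
    using that by (auto simp: abs_if)
qed (use assms in \<open>auto intro!: continuous_intros\<close>)

section \<open>Differentiability of integrals of Green functions\<close>

lemma set_integral_sum:
  fixes h :: "'i \<Rightarrow> 'a \<Rightarrow> real"
  assumes "\<And>i. i \<in> I \<Longrightarrow> set_integrable M A (h i)"
  shows "set_integrable M A (\<lambda>y. \<Sum>i\<in>I. h i y)"
    and "(LINT y:A|M. \<Sum>i\<in>I. h i y) = (\<Sum>i\<in>I. LINT y:A|M. h i y)"
proof -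
  have "set_integrable M A (\<lambda>y. \<Sum>i\<in>I. h i y) \<and>
      (LINT y:A|M. \<Sum>i\<in>I. h i y) = (\<Sum>i\<in>I. LINT y:A|M. h i y)"
    using assms
  proof (induction I rule: infinite_finite_induct)
    case (insert i I)
    then show ?case
      using set_integral_add[of M A "h i" "\<lambda>y. \<Sum>i\<in>I. h i y"] by simp
  qed (auto simp: set_integrable_def set_lebesgue_integral_def)
  then show "set_integrable M A (\<lambda>y. \<Sum>i\<in>I. h i y)"
    and "(LINT y:A|M. \<Sum>i\<in>I. h i y) = (\<Sum>i\<in>I. LINT y:A|M. h i y)" by auto
qed

text \<open>For \<open>z \<le> z'\<close> the difference is \<open>(z' - z) * p\<close> left of both
  kinks and \<open>- (z' - z) * q\<close> right of them, so it decays linearly at both ends. As the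
  kinks keep distance \<open>\<epsilon>\<close> from the ends, the missing linear factor of the
  weight is at least \<open>\<epsilon>\<close> where it is inserted.\<close>

lemma green_lipschitz:
  assumes "0 < \<epsilon>" "z \<in> {a + \<epsilon>..b - \<epsilon>}" "z' \<in> {a + \<epsilon>..b - \<epsilon>}" and y: "y \<in> {a<..<b}"
  shows "\<bar>green a b z y - green a b z' y\<bar> \<le> \<bar>z - z'\<bar> * ((y - a) * (b - y) / (\<epsilon> * (b - a)))"
proof -
  have *: "\<bar>green a b z y - green a b z' y\<bar> \<le> (z' - z) * ((y - a) * (b - y) / (\<epsilon> * (b - a)))"
    if z: "z \<le> z'" "z \<in> {a + \<epsilon>..b - \<epsilon>}" "z' \<in> {a + \<epsilon>..b - \<epsilon>}" for z z'
  proof -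
    define p where "p = (y - a) / (b - a)"
    define q where "q = (b - y) / (b - a)"
    define m where "m = max 0 (y - z) - max 0 (y - z')"
    have p: "0 \<le> p" and q: "0 \<le> q" and pq: "p + q = 1"
      using y by (auto simp: p_def q_def simp flip: add_divide_distrib)
    \<comment> \<open>The weight is read as \<open>p\<close> times
      \<open>(b - y) / \<epsilon>\<close> or as \<open>q\<close> times
      \<open>(y - a) / \<epsilon>\<close>. The second factor is at least 1 for
      \<open>y \<le> z'\<close>, respectively for \<open>z \<le> y\<close>.\<close>
    have w: "(y - a) * (b - y) / (\<epsilon> * (b - a)) = p * ((b - y) / \<epsilon>)"
      "(y - a) * (b - y) / (\<epsilon> * (b - a)) = q * ((y - a) / \<epsilon>)"
      by (simp_all add: p_def q_def field_simps)
    have pw: "p \<le> (y - a) * (b - y) / (\<epsilon> * (b - a))" if "y \<le> z'"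
    proof -
      have "1 \<le> (b - y) / \<epsilon>" using that z assms by (simp add: field_simps)
      then show ?thesis unfolding w(1) using p mult_left_mono by fastforce
    qed
    have qw: "q \<le> (y - a) * (b - y) / (\<epsilon> * (b - a))" if "z \<le> y"
    proof -
      have "1 \<le> (y - a) / \<epsilon>" using that z assms by (simp add: field_simps)
      then show ?thesis unfolding w(2) using q mult_left_mono by fastforce
    qed
    have eq: "green a b z y - green a b z' y = (z' - z) * p - m"
      by (simp add: green_def m_def p_def algebra_simps diff_divide_distrib add_divide_distrib)
    have m: "0 \<le> m" "m \<le> z' - z" "y \<le> z \<Longrightarrow> m = 0" "z' \<le> y \<Longrightarrow> m = z' - z"
      using z by (auto simp: m_def)
    have up: "(z' - z) * p - m \<le> (z' - z) * ((y - a) * (b - y) / (\<epsilon> * (b - a)))"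
    proof (cases "y \<le> z'")
      case True
      then have "(z' - z) * p \<le> (z' - z) * ((y - a) * (b - y) / (\<epsilon> * (b - a)))"
        using pw z by (intro mult_left_mono) auto
      with m show ?thesis by linarith
    next
      case False
      have "(z' - z) * p - m \<le> 0"
        using m(4) False pq q z mult_left_mono[of p 1 "z' - z"] by auto
      also have "0 \<le> (z' - z) * ((y - a) * (b - y) / (\<epsilon> * (b - a)))"
        using z y assms by (intro mult_nonneg_nonneg divide_nonneg_pos) auto
      finally show ?thesis .
    qed
    have lo: "m - (z' - z) * p \<le> (z' - z) * ((y - a) * (b - y) / (\<epsilon> * (b - a)))"
    proof (cases "z \<le> y")
      case True
      \<comment> \<open>Bounding the ramp difference \<open>m\<close> by \<open>z' - z\<close>
        leaves the factor \<open>1 - p = q\<close>.\<close>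
      have "m - (z' - z) * p \<le> (z' - z) * q"
        using m(2) pq by (metis add_diff_cancel_left' diff_right_mono mult.right_neutral right_diff_distrib)
      also have "\<dots> \<le> (z' - z) * ((y - a) * (b - y) / (\<epsilon> * (b - a)))"
        using qw[OF True] z by (intro mult_left_mono) auto
      finally show ?thesis .
    next
      case False
      have "m - (z' - z) * p \<le> 0"
        using m(3) False p z by simp
      also have "0 \<le> (z' - z) * ((y - a) * (b - y) / (\<epsilon> * (b - a)))"
        using z y assms by (intro mult_nonneg_nonneg divide_nonneg_pos) auto
      finally show ?thesis .
    qed
    show ?thesis unfolding eq using up lo by linarith
  qed
  show ?thesis
  proof (cases "z \<le> z'")
    case True
    then show ?thesis using *[of z z'] assms by simp
  next
    case False
    then show ?thesis using *[of z' z] assms by (simp add: abs_minus_commute)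
  qed
qed

text \<open>Dominated convergence along an arbitrary sequence of kinks tending to \<open>z0\<close>.
  The quotients converge for every \<open>y\<close> except \<open>z0\<close>, a null set.\<close>

lemma green_integral_differentiable:
  assumes ab: "a < b" and g: "\<And>w. w \<in> H10 a b \<Longrightarrow> set_integrable lebesgue {a<..<b} (\<lambda>y. g y * w y)"
    and z0: "z0 \<in> {a<..<b}"
  shows "\<exists>d. ((\<lambda>z. LINT y:{a<..<b}|lebesgue. g y * green a b z y) has_real_derivative d) (at z0)"
proof -
  \<comment> \<open>Half the distance to the nearer end point: all kinks in \<open>S\<close> then
    stay at least \<open>\<epsilon>\<close> away from \<open>a\<close> and \<open>b\<close>.\<close>
  define \<epsilon> where "\<epsilon> = min (z0 - a) (b - z0) / 2"
  define S where "S = {z0 - \<epsilon><..<z0 + \<epsilon>}"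
  define \<psi> where "\<psi> y = (y - a) * (b - y)" for y
  define \<Phi> where "\<Phi> z = (LINT y:{a<..<b}|lebesgue. g y * green a b z y)" for z
  \<comment> \<open>The derivative of \<open>green a b z y\<close> with respect to \<open>z\<close>
    at \<open>z0\<close>, for \<open>y \<noteq> z0\<close>.\<close>
  define d0 where "d0 y = - ((y - a) / (b - a)) + indicator {z0<..} y" for y
  have \<epsilon>: "0 < \<epsilon>" "a + \<epsilon> \<le> z0 - \<epsilon>" "z0 + \<epsilon> \<le> b - \<epsilon>" using z0 by (auto simp: \<epsilon>_def)
  have SD: "z \<in> {a + \<epsilon>..b - \<epsilon>}" if "z \<in> S" for z
    using that \<epsilon> by (auto simp: S_def)
  have z0S: "z0 \<in> S" using \<epsilon> by (simp add: S_def)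
  have g\<psi>: "set_integrable lebesgue {a<..<b} (\<lambda>y. g y * \<psi> y)"
    using g[OF parabola_in_H10[OF ab]] by (simp add: \<psi>_def)
  have gG: "set_integrable lebesgue {a<..<b} (\<lambda>y. g y * green a b z y)" if "z \<in> S" for z
    by (intro g green_in_H10 ab) (use SD[OF that] \<epsilon> in auto)
  \<comment> \<open>Measurability of \<open>g\<close> alone is recovered by dividing the integrable
    product by the parabola, which is positive inside the interval. At \<open>a\<close> and
    \<open>b\<close> the convention \<open>0 / 0 = 0\<close> is used.\<close>
  have gm: "(\<lambda>y. indicator {a<..<b} y * g y) \<in> borel_measurable lebesgue"
  proof -
    have eq: "(\<lambda>y. indicator {a<..<b} y * g y) =
        (\<lambda>y. (indicator {a<..<b} y *\<^sub>R (g y * \<psi> y)) / \<psi> y)"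
      by (auto simp: indicator_def \<psi>_def fun_eq_iff)
    show ?thesis
      unfolding eq
    proof (rule borel_measurable_divide)
      show "(\<lambda>y. indicator {a<..<b} y *\<^sub>R (g y * \<psi> y)) \<in> borel_measurable lebesgue"
        using set_integrable_imp_set_borel_measurable[OF g\<psi>] by (simp add: set_borel_measurable_def)
      show "\<psi> \<in> borel_measurable lebesgue"
        unfolding \<psi>_def by (intro measurable_completion) (simp add: measurable_lborel1)
    qed
  qed
  have "((\<lambda>z. (\<Phi> z - \<Phi> z0) / (z - z0)) \<longlongrightarrow> (LINT y:{a<..<b}|lebesgue. g y * d0 y)) (at z0 within S)"
    unfolding tendsto_at_iff_sequentially
  proof (intro allI impI)
    fix X :: "nat \<Rightarrow> real" assume X: "\<forall>i. X i \<in> S - {z0}" and lim: "X \<longlonglongrightarrow> z0"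
    define q where "q i y = (green a b (X i) y - green a b z0 y) / (X i - z0)" for i y
    have gq: "set_integrable lebesgue {a<..<b} (\<lambda>y. g y * q i y)"
      and Dq: "(\<Phi> (X i) - \<Phi> z0) / (X i - z0) = (LINT y:{a<..<b}|lebesgue. g y * q i y)" for i
    proof -
      have Xi: "X i \<in> S" using X by auto
      have eq: "(\<lambda>y. g y * q i y) = (\<lambda>y. (g y * green a b (X i) y - g y * green a b z0 y) / (X i - z0))"
        by (simp add: q_def algebra_simps fun_eq_iff)
      show "set_integrable lebesgue {a<..<b} (\<lambda>y. g y * q i y)"
        unfolding eq by (intro set_integrable_divide set_integral_diff gG Xi z0S)
      show "(\<Phi> (X i) - \<Phi> z0) / (X i - z0) = (LINT y:{a<..<b}|lebesgue. g y * q i y)"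
        unfolding eq \<Phi>_def by (simp add: set_integral_diff(2)[OF gG[OF Xi] gG[OF z0S]])
    qed
    have "(\<lambda>i. LINT y|lebesgue. indicator {a<..<b} y *\<^sub>R (g y * q i y)) \<longlonglongrightarrow>
        (LINT y|lebesgue. indicator {a<..<b} y *\<^sub>R (g y * d0 y))"
    proof (rule integral_dominated_convergence[where
          w = "\<lambda>y. \<bar>indicator {a<..<b} y *\<^sub>R (g y * \<psi> y)\<bar> / (\<epsilon> * (b - a))"])
      have "d0 \<in> borel_measurable lebesgue"
        unfolding d0_def by (intro measurable_completion) (simp add: measurable_lborel1)
      then have "(\<lambda>y. (indicator {a<..<b} y * g y) * d0 y) \<in> borel_measurable lebesgue"
        using gm by simp
      then show "(\<lambda>y. indicator {a<..<b} y *\<^sub>R (g y * d0 y)) \<in> borel_measurable lebesgue"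
        by (simp add: mult.assoc)
      show "(\<lambda>y. indicator {a<..<b} y *\<^sub>R (g y * q i y)) \<in> borel_measurable lebesgue" for i
        using gq[of i] by (simp add: set_integrable_def borel_measurable_integrable)
      show "integrable lebesgue (\<lambda>y. \<bar>indicator {a<..<b} y *\<^sub>R (g y * \<psi> y)\<bar> / (\<epsilon> * (b - a)))"
        using g\<psi> by (intro integrable_divide integrable_abs) (simp add: set_integrable_def)
      have "AE y in lebesgue. y \<noteq> z0"
        by (intro AE_not_in[of "{z0}", simplified] null_setsI) auto
      then show "AE y in lebesgue. (\<lambda>i. indicator {a<..<b} y *\<^sub>R (g y * q i y)) \<longlonglongrightarrow>
          indicator {a<..<b} y *\<^sub>R (g y * d0 y)"
      proof eventually_elim
        case (elim y)
        \<comment> \<open>Once \<open>X i\<close> lies on the same side of \<open>y\<close> as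
          \<open>z0\<close>, the Green function is affine in the kink between them, so the quotient
          equals \<open>d0 y\<close> exactly.\<close>
        have ev: "eventually (\<lambda>i. q i y = d0 y) sequentially"
        proof (cases "y < z0")
          case True
          have "eventually (\<lambda>i. y < X i) sequentially"
            using order_tendstoD(1)[OF lim True] .
          then show ?thesis
          proof eventually_elim
            case (elim i)
            have "green a b (X i) y - green a b z0 y = d0 y * (X i - z0)"
              using True elim by (simp add: d0_def green_def diff_divide_distrib add_divide_distrib algebra_simps)
            then show ?case using X by (simp add: q_def)
          qed
        next
          case False
          with elim have y: "z0 < y" by simp
          have "eventually (\<lambda>i. X i < y) sequentially"
            using order_tendstoD(2)[OF lim y] .
          then show ?thesis
          proof eventually_elim
            case (elim i)
            have "green a b (X i) y - green a b z0 y = d0 y * (X i - z0)"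
              using y elim by (simp add: d0_def green_def diff_divide_distrib add_divide_distrib algebra_simps)
            then show ?case using X by (simp add: q_def)
          qed
        qed
        then have "eventually (\<lambda>i. indicator {a<..<b} y *\<^sub>R (g y * q i y) =
            indicator {a<..<b} y *\<^sub>R (g y * d0 y)) sequentially"
          by eventually_elim simp
        then show ?case by (rule tendsto_eventually)
      qed
      show "AE y in lebesgue. norm (indicator {a<..<b} y *\<^sub>R (g y * q i y)) \<le>
          \<bar>indicator {a<..<b} y *\<^sub>R (g y * \<psi> y)\<bar> / (\<epsilon> * (b - a))" for i
      proof (rule AE_I2)
        fix y :: real
        show "norm (indicator {a<..<b} y *\<^sub>R (g y * q i y)) \<le>
          \<bar>indicator {a<..<b} y *\<^sub>R (g y * \<psi> y)\<bar> / (\<epsilon> * (b - a))"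
        proof (cases "y \<in> {a<..<b}")
          case True
          have Xi: "X i \<in> S" "X i \<noteq> z0" using X by auto
          have "\<bar>green a b (X i) y - green a b z0 y\<bar> \<le> \<bar>X i - z0\<bar> * (\<psi> y / (\<epsilon> * (b - a)))"
            unfolding \<psi>_def using green_lipschitz[OF \<epsilon>(1) SD[OF Xi(1)] SD[OF z0S] True] .
          then have "\<bar>q i y\<bar> \<le> \<psi> y / (\<epsilon> * (b - a))"
            using Xi(2) by (simp add: q_def divide_le_eq mult.commute)
          then have "\<bar>g y\<bar> * \<bar>q i y\<bar> \<le> \<bar>g y\<bar> * (\<psi> y / (\<epsilon> * (b - a)))"
            by (intro mult_left_mono) auto
          moreover have "0 \<le> \<psi> y" using True by (simp add: \<psi>_def)
          ultimately show ?thesis using True by (simp add: abs_mult)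
        qed simp
      qed
    qed
    then show "((\<lambda>z. (\<Phi> z - \<Phi> z0) / (z - z0)) \<circ> X) \<longlonglongrightarrow> (LINT y:{a<..<b}|lebesgue. g y * d0 y)"
      by (simp add: comp_def Dq set_lebesgue_integral_def)
  qed
  moreover have "at z0 within S = at z0"
    using z0S by (intro at_within_open) (auto simp: S_def)
  ultimately have "(\<Phi> has_real_derivative (LINT y:{a<..<b}|lebesgue. g y * d0 y)) (at z0)"
    by (simp add: has_field_derivative_iff)
  then show ?thesis unfolding \<Phi>_def by blast
qed

text \<open>By \<open>uh_eq_green\<close> the integral is a sum of slopes times differences of
  \<open>\<Phi>\<close> at neighbouring nodes. The moving nodes inside the integral thus enter
  through a function of one real variable.\<close>

lemma has_some_gradient_linear_functional:
  assumes m: "mesh a b N x0" and N: "2 \<le> N"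
    and g: "\<And>w. w \<in> H10 a b \<Longrightarrow> set_integrable lebesgue {a<..<b} (\<lambda>y. g y * w y)"
  shows "has_some_gradient N (\<lambda>u x. LINT y:{a<..<b}|lebesgue. g y * uh a b N u x y) u0 x0"
proof -
  define \<Phi> where "\<Phi> z = (LINT y:{a<..<b}|lebesgue. g y * green a b z y)" for z
  have ab: "a < b" using mesh_less[OF m, of 0 N] N by simp
  have \<Phi>: "has_some_gradient N (\<lambda>u x. \<Phi> (nodes a b N x k)) u0 x0" if "k \<le> N" for k
  proof (cases "k \<in> {1..N - 1}")
    case True
    obtain d where "(\<Phi> has_real_derivative d) (at (nodes a b N x0 k))"
      using green_integral_differentiable[OF ab g mesh_interior_nodes[OF m True]]
      unfolding \<Phi>_def by blast
    then show ?thesis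
      by (rule has_some_gradient_compose[OF has_some_gradient_nodes[OF that]])
  next
    case False
    \<comment> \<open>The end nodes do not move, so the composite is constant there;
      differentiability of \<open>\<Phi>\<close> was shown at interior points.\<close>
    with that have "k = 0 \<or> k = N" by auto
    then show ?thesis using N by (auto intro: gradient_intros)
  qed
  have "has_some_gradient N (\<lambda>u x. \<Sum>j<N. Dh (vals N u) (nodes a b N x) j *
      (\<Phi> (nodes a b N x (j + 1)) - \<Phi> (nodes a b N x j))) u0 x0"
    unfolding Dh_def using m by (intro gradient_intros \<Phi>) (auto simp: mesh_def)
  then show ?thesis
  proof (rule has_some_gradient_mesh_cong[OF _ m])
    fix u x assume mx: "mesh a b N x"
    let ?X = "nodes a b N x"
    have i: "set_integrable lebesgue {a<..<b} (\<lambda>y. g y * green a b (?X k) y)" if "k \<le> N" for k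
      using mesh_nodes_bounds[OF mx _ that] N by (intro g green_in_H10 ab) auto
    have i2: "set_integrable lebesgue {a<..<b}
        (\<lambda>y. Dh (vals N u) ?X j * (g y * green a b (?X (j + 1)) y - g y * green a b (?X j) y))" if "j < N" for j
      using that by (intro set_integrable_mult_right set_integral_diff(1) i) auto
    have "(LINT y:{a<..<b}|lebesgue. g y * uh a b N u x y) = (LINT y:{a<..<b}|lebesgue.
        (\<Sum>j<N. Dh (vals N u) ?X j * (g y * green a b (?X (j + 1)) y - g y * green a b (?X j) y)))"
      by (simp add: uh_eq_green[OF mx N] sum_distrib_left algebra_simps)
    also have "\<dots> = (\<Sum>j<N. Dh (vals N u) ?X j * (\<Phi> (?X (j + 1)) - \<Phi> (?X j)))"
      using i2 by (subst set_integral_sum(2)) (auto simp: \<Phi>_def set_integral_diff(2)[OF i i])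
    finally show "(\<Sum>j<N. Dh (vals N u) ?X j * (\<Phi> (?X (j + 1)) - \<Phi> (?X j))) =
        (LINT y:{a<..<b}|lebesgue. g y * uh a b N u x y)" by simp
  qed
qed

section \<open>Differentiability of the discrete energy\<close>

text \<open>The mean value theorem gives the increment as \<open>h' c * (v - w)\<close> with
  \<open>c\<close> between \<open>v\<close> and \<open>w\<close>; replacing \<open>c\<close> by
  \<open>w\<close> costs another factor \<open>\<bar>v - w\<bar>\<close> by the Lipschitz
  bound.\<close>

lemma lipschitz_derivative_remainder:
  fixes h h' :: "real \<Rightarrow> real"
  assumes der: "\<And>v. (h has_real_derivative h' v) (at v)"
    and lip: "\<And>v w. \<bar>h' v - h' w\<bar> \<le> L * \<bar>v - w\<bar>"
  shows "\<bar>h v - h w - h' w * (v - w)\<bar> \<le> L * (v - w)\<^sup>2"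
proof -
  have "\<exists>c. \<bar>c - w\<bar> \<le> \<bar>v - w\<bar> \<and> h v - h w = h' c * (v - w)"
  proof (cases v w rule: linorder_cases)
    case less
    then obtain c where "v < c" "c < w" "h w - h v = (w - v) * h' c"
      using MVT2[of v w h h'] der by blast
    then show ?thesis by (intro exI[of _ c]) (auto simp: algebra_simps)
  next
    case greater
    then obtain c where "w < c" "c < v" "h v - h w = (v - w) * h' c"
      using MVT2[of w v h h'] der by blast
    then show ?thesis by (intro exI[of _ c]) (auto simp: algebra_simps)
  qed auto
  then obtain c where c: "\<bar>c - w\<bar> \<le> \<bar>v - w\<bar>" "h v - h w = h' c * (v - w)" by blast
  have "0 \<le> L"
    using lip[of 1 0] abs_ge_zero[of "h' 1 - h' 0"] by simp
  then have "\<bar>h' c - h' w\<bar> \<le> L * \<bar>v - w\<bar>"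
    using lip[of c w] c(1) by (meson mult_left_mono order_trans)
  then have "\<bar>h' c - h' w\<bar> * \<bar>v - w\<bar> \<le> L * \<bar>v - w\<bar> * \<bar>v - w\<bar>"
    by (rule mult_right_mono) simp
  moreover have "h v - h w - h' w * (v - w) = (h' c - h' w) * (v - w)"
    using c(2) by (simp add: algebra_simps)
  moreover have "L * (v - w)\<^sup>2 = L * \<bar>v - w\<bar> * \<bar>v - w\<bar>"
    by (simp add: power2_eq_square)
  ultimately show ?thesis
    by (simp only: abs_mult)
qed

text \<open>In ramp form each summand splits into a slope change times a ramp difference bounded by
  \<open>b - a\<close>, and a fixed slope times the change of that ramp difference, which the node
  shifts control. The squares on the right have zero gradient at \<open>(u0, x0)\<close>, and
  \<open>K\<close> depends on the reference data only.\<close>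

lemma uh_diff_bound:
  assumes m0: "mesh a b N x0" and N: "2 \<le> N"
  shows "\<exists>K\<ge>0. \<forall>u x y. mesh a b N x \<longrightarrow>
    (uh a b N u x y - uh a b N u0 x0 y)\<^sup>2 \<le> K * (\<Sum>j<N.
      (Dh (vals N u) (nodes a b N x) j - Dh (vals N u0) (nodes a b N x0) j)\<^sup>2 +
      (nodes a b N x (j + 1) - nodes a b N x0 (j + 1))\<^sup>2 + (nodes a b N x j - nodes a b N x0 j)\<^sup>2)"
proof -
  define D0 where "D0 = Dh (vals N u0) (nodes a b N x0)"
  define X0 where "X0 = nodes a b N x0"
  \<comment> \<open>The factor 3 anticipates the weighted square inequality below: it is the weight
    of the slope part, and also \<open>3 / 2\<close> times the 2 that arises from squaring a sum of
    two node shifts.\<close>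
  define K1 where "K1 = 3 * ((b - a)\<^sup>2 + (\<Sum>j<N. (D0 j)\<^sup>2))"
  have K1: "3 * (b - a)\<^sup>2 \<le> K1" "\<And>j. j < N \<Longrightarrow> 3 * (D0 j)\<^sup>2 \<le> K1"
  proof -
    have "0 \<le> (\<Sum>j<N. (D0 j)\<^sup>2)"
      by (simp add: sum_nonneg)
    then show "3 * (b - a)\<^sup>2 \<le> K1"
      by (simp add: K1_def)
    fix j assume "j < N"
    then have "(D0 j)\<^sup>2 \<le> (\<Sum>j<N. (D0 j)\<^sup>2)"
      by (intro member_le_sum) auto
    then show "3 * (D0 j)\<^sup>2 \<le> K1"
      unfolding K1_def by (intro mult_left_mono add_increasing) auto
  qed
  have "(uh a b N u x y - uh a b N u0 x0 y)\<^sup>2 \<le> (real N * K1) * (\<Sum>j<N.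
      (Dh (vals N u) (nodes a b N x) j - D0 j)\<^sup>2 +
      (nodes a b N x (j + 1) - X0 (j + 1))\<^sup>2 + (nodes a b N x j - X0 j)\<^sup>2)" if m: "mesh a b N x" for u x y
  proof -
    let ?D = "Dh (vals N u) (nodes a b N x)" and ?X = "nodes a b N x"
    define r where "r X j = max 0 (y - X j) - max 0 (y - X (j + 1))" for X :: "nat \<Rightarrow> real" and j
    have "uh a b N u x y - uh a b N u0 x0 y = (\<Sum>j<N. ?D j * r ?X j - D0 j * r X0 j)"
      unfolding r_def D0_def X0_def uh_eq_max[OF m N] uh_eq_max[OF m0 N] by (simp add: sum_subtractf)
    then have "(uh a b N u x y - uh a b N u0 x0 y)\<^sup>2 \<le> (\<Sum>j<N. (?D j * r ?X j - D0 j * r X0 j)\<^sup>2) * real N"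
      using sum_squared_le_sum_of_squares[of "\<lambda>j. ?D j * r ?X j - D0 j * r X0 j" "{..<N}"] by simp
    also have "\<dots> \<le> (\<Sum>j<N. K1 * ((?D j - D0 j)\<^sup>2 + (?X (j + 1) - X0 (j + 1))\<^sup>2 + (?X j - X0 j)\<^sup>2)) * real N"
    proof (intro mult_right_mono sum_mono)
      fix j assume "j \<in> {..<N}"
      then have j: "j < N" by simp
      define A where "A = (?D j - D0 j)\<^sup>2"
      define B where "B = (?X (j + 1) - X0 (j + 1))\<^sup>2"
      define C where "C = (?X j - X0 j)\<^sup>2"
      have "0 \<le> r ?X j" "r ?X j \<le> b - a"
        using mesh_nodes_bounds[OF m, of j] mesh_nodes_bounds[OF m, of "j + 1"] mesh_less[OF m, of j "j + 1"] j
        by (auto simp: r_def)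
      then have r2: "(r ?X j)\<^sup>2 \<le> (b - a)\<^sup>2" by (intro power_mono)
      have d: "\<bar>r ?X j - r X0 j\<bar> \<le> \<bar>?X (j + 1) - X0 (j + 1)\<bar> + \<bar>?X j - X0 j\<bar>"
        unfolding r_def by linarith
      have "(r ?X j - r X0 j)\<^sup>2 \<le> (\<bar>?X (j + 1) - X0 (j + 1)\<bar> + \<bar>?X j - X0 j\<bar>)\<^sup>2"
        using power_mono[OF d, of 2] by simp
      also have "\<dots> \<le> 2 * (B + C)"
        using sum_squares_bound[of "\<bar>?X (j + 1) - X0 (j + 1)\<bar>" "\<bar>?X j - X0 j\<bar>"]
        by (simp add: B_def C_def power2_sum)
      finally have d2: "(r ?X j - r X0 j)\<^sup>2 \<le> 2 * (B + C)" .
      have "?D j * r ?X j - D0 j * r X0 j = (?D j - D0 j) * r ?X j + D0 j * (r ?X j - r X0 j)"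
        by (simp add: algebra_simps)
      moreover have "(p + q)\<^sup>2 \<le> 3 * p\<^sup>2 + 3 / 2 * q\<^sup>2" for p q :: real
      proof -
        have "3 * p\<^sup>2 + 3 / 2 * q\<^sup>2 - (p + q)\<^sup>2 = (2 * p - q)\<^sup>2 / 2"
          by (simp add: power2_eq_square field_simps)
        then show ?thesis using zero_le_power2[of "2 * p - q"] by linarith
      qed
      ultimately have "(?D j * r ?X j - D0 j * r X0 j)\<^sup>2 \<le>
          3 * (A * (r ?X j)\<^sup>2) + 3 / 2 * ((D0 j)\<^sup>2 * (r ?X j - r X0 j)\<^sup>2)"
        by (metis A_def power_mult_distrib)
      also have "\<dots> \<le> 3 * (A * (b - a)\<^sup>2) + 3 / 2 * ((D0 j)\<^sup>2 * (2 * (B + C)))"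
        using r2 d2 by (intro add_mono mult_left_mono) (auto simp: A_def)
      also have "\<dots> = A * (3 * (b - a)\<^sup>2) + (B + C) * (3 * (D0 j)\<^sup>2)" by simp
      also have "\<dots> \<le> A * K1 + (B + C) * K1"
        using K1 j by (intro add_mono mult_left_mono) (auto simp: A_def B_def C_def)
      finally show "(?D j * r ?X j - D0 j * r X0 j)\<^sup>2 \<le> K1 * (A + B + C)"
        by (simp add: algebra_simps)
    qed simp
    also have "\<dots> = (real N * K1) * (\<Sum>j<N. (?D j - D0 j)\<^sup>2 + (?X (j + 1) - X0 (j + 1))\<^sup>2 + (?X j - X0 j)\<^sup>2)"
      by (simp add: sum_distrib_left sum_distrib_right mult_ac)
    finally show ?thesis .
  qed
  moreover have "0 \<le> real N * K1"
    unfolding K1_def by (intro mult_nonneg_nonneg add_nonneg_nonneg sum_nonneg) auto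
  ultimately show ?thesis unfolding D0_def X0_def by blast
qed

lemma has_some_gradient_potential:
  assumes m0: "mesh a b N x0" and N: "2 \<le> N"
    and F_deriv: "\<And>y v. y \<in> {a<..<b} \<Longrightarrow> (F y has_real_derivative f y v) (at v)"
    and f_lipschitz: "\<And>y v w. y \<in> {a<..<b} \<Longrightarrow> \<bar>f y v - f y w\<bar> \<le> L * \<bar>v - w\<bar>"
    and F_integrable: "\<And>v. v \<in> H10 a b \<Longrightarrow> set_integrable lebesgue {a<..<b} (\<lambda>y. F y (v y))"
    and f_integrable: "\<And>v w. v \<in> H10 a b \<Longrightarrow> w \<in> H10 a b \<Longrightarrow>
          set_integrable lebesgue {a<..<b} (\<lambda>y. f y (v y) * w y)"
  shows "has_some_gradient N (\<lambda>u x. LINT y:{a<..<b}|lebesgue. F y (uh a b N u x y)) u0 x0"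
proof -
  define v0 where "v0 = uh a b N u0 x0"
  define P where "P u x = (LINT y:{a<..<b}|lebesgue. F y (uh a b N u x y))" for u x
  define J where "J u x = (LINT y:{a<..<b}|lebesgue. f y (v0 y) * uh a b N u x y)" for u x
  define R where "R u x = P u x - P u0 x0 - (J u x - J u0 x0)" for u x
  define Q where "Q u x = (\<Sum>j<N.
      (Dh (vals N u) (nodes a b N x) j - Dh (vals N u0) (nodes a b N x0) j)\<^sup>2 +
      (nodes a b N x (j + 1) - nodes a b N x0 (j + 1))\<^sup>2 + (nodes a b N x j - nodes a b N x0 j)\<^sup>2)" for u x
  obtain K where K: "0 \<le> K"
    "\<And>u x y. mesh a b N x \<Longrightarrow> (uh a b N u x y - v0 y)\<^sup>2 \<le> K * Q u x"
    using uh_diff_bound[OF m0 N, of u0] unfolding Q_def v0_def by blast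
  have ab: "a < b" using mesh_less[OF m0, of 0 N] N by simp
  have L: "0 \<le> L"
    \<comment> \<open>The midpoint serves as a sample point of the interval, where the Lipschitz
      bound forces \<open>L\<close> to be nonnegative.\<close>
    using f_lipschitz[of "(a + b) / 2" 1 0] ab abs_ge_zero[of "f ((a + b) / 2) 1 - f ((a + b) / 2) 0"] by simp
  have v0: "v0 \<in> H10 a b" unfolding v0_def by (rule uh_in_H10[OF m0 N])
  have Q: "has_gradient N Q u0 x0 (\<lambda>_. 0) (\<lambda>_. 0)"
  proof -
    have 1: "has_gradient N (\<lambda>u x. (Dh (vals N u) (nodes a b N x) j - Dh (vals N u0) (nodes a b N x0) j)\<^sup>2)
        u0 x0 (\<lambda>_. 0) (\<lambda>_. 0)" if "j < N" for j
      using that m0 unfolding Dh_def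
      by (intro has_gradient_square_diff gradient_intros) (auto simp: mesh_def)
    have 2: "has_gradient N (\<lambda>u x. (nodes a b N x j - nodes a b N x0 j)\<^sup>2) u0 x0 (\<lambda>_. 0) (\<lambda>_. 0)"
      if "j \<le> N" for j
      using that by (intro has_gradient_square_diff gradient_intros)
    show ?thesis
      unfolding Q_def
      using has_gradient_add[OF has_gradient_add[OF 1 2] 2] by (intro has_gradient_zero_sum) auto
  qed
  have Rbound: "\<bar>R u x\<bar> \<le> (L * K * (b - a)) * Q u x" if m: "mesh a b N x" for u x
  proof -
    define v where "v = uh a b N u x"
    have v: "v \<in> H10 a b" unfolding v_def by (rule uh_in_H10[OF m N])
    \<comment> \<open>The product with \<open>v - v0\<close> is written out so that integrability
      follows from \<open>f_integrable\<close> for \<open>v\<close> and \<open>v0\<close>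
      separately.\<close>
    define e where "e y = F y (v y) - F y (v0 y) - (f y (v0 y) * v y - f y (v0 y) * v0 y)" for y
    have e_int: "set_integrable lebesgue {a<..<b} e"
      unfolding e_def by (intro set_integral_diff F_integrable f_integrable v v0)
    have "R u x = (LINT y:{a<..<b}|lebesgue. e y)"
      unfolding R_def P_def J_def e_def v_def[symmetric] v0_def[symmetric]
      by (simp add: set_integral_diff F_integrable f_integrable v v0)
    also have "\<bar>\<dots>\<bar> \<le> (LINT y:{a<..<b}|lebesgue. \<bar>e y\<bar>)"
      using set_integral_norm_bound[OF e_int] by simp
    also have "\<dots> \<le> (LINT y:{a<..<b}|lebesgue. L * (K * Q u x))"
    proof (rule set_integral_mono)
      show "set_integrable lebesgue {a<..<b} (\<lambda>y. \<bar>e y\<bar>)"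
        using set_integrable_abs[OF e_int] .
      show "set_integrable lebesgue {a<..<b} (\<lambda>y. L * (K * Q u x))"
        by (intro set_integrable_continuous_Ioo continuous_intros)
      fix y assume y: "y \<in> {a<..<b}"
      have "e y = F y (v y) - F y (v0 y) - f y (v0 y) * (v y - v0 y)"
        by (simp add: e_def algebra_simps)
      also have "\<bar>\<dots>\<bar> \<le> L * (v y - v0 y)\<^sup>2"
        by (intro lipschitz_derivative_remainder F_deriv f_lipschitz y)
      also have "\<dots> \<le> L * (K * Q u x)"
        using K(2)[OF m] L unfolding v_def by (intro mult_left_mono)
      finally show "\<bar>e y\<bar> \<le> L * (K * Q u x)" .
    qed
    also have "\<dots> = (L * K * (b - a)) * Q u x"
      using ab by (simp add: set_integral_const_Ioo)
    finally show ?thesis .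
  qed
  have "has_gradient N (\<lambda>u x. (L * K * (b - a)) * Q u x) u0 x0 (\<lambda>_. 0) (\<lambda>_. 0)"
    using has_gradient_compose[OF Q, of "\<lambda>r. (L * K * (b - a)) * r" "L * K * (b - a)"]
    by (auto intro!: derivative_eq_intros)
  then have "has_gradient N R u0 x0 (\<lambda>_. 0) (\<lambda>_. 0)"
    by (rule has_gradient_squeeze[OF _ _ m0 _ Rbound]) (auto simp: Q_def R_def)
  then have "has_some_gradient N R u0 x0"
    by (auto simp: has_some_gradient_def)
  then have "has_some_gradient N (\<lambda>u x. R u x + P u0 x0 + (J u x - J u0 x0)) u0 x0"
    unfolding J_def
    by (intro gradient_intros has_some_gradient_linear_functional[OF m0 N] f_integrable v0)
  then show ?thesis by (simp add: R_def P_def)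
qed

text \<open>Off the nodes \<open>deriv\<close> is the constant slope of the element, and the nodes
  form a null set. The Dirichlet part becomes a rational expression in nodal values and nodes, to
  which the gradient rules apply.\<close>

lemma energy_uh:
  assumes m: "mesh a b N x" and N: "2 \<le> N"
    and F_int: "set_integrable lebesgue {a<..<b} (\<lambda>y. F y (uh a b N u x y))"
  shows "energy a b \<alpha> F (uh a b N u x) =
    (\<Sum>j<N. \<alpha> / 2 * (Dh (vals N u) (nodes a b N x) j)\<^sup>2 * (nodes a b N x (j + 1) - nodes a b N x j)) +
    (LINT y:{a<..<b}|lebesgue. F y (uh a b N u x y))"
proof -
  let ?X = "nodes a b N x" and ?D = "Dh (vals N u) (nodes a b N x)"
  have ind: "set_integrable lebesgue {a<..<b} (\<lambda>y. c * indicator {?X j<..<?X (j + 1)} y)" for c :: real and j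
    by (rule set_integrable_bounded_Ioo[where M = "\<bar>c\<bar>"])
       (auto simp: indicator_def intro!: set_borel_measurable_lebesgueI)
  have len: "(LINT y:{a<..<b}|lebesgue. c * indicator {?X j<..<?X (j + 1)} y) = c * (?X (j + 1) - ?X j)"
    if j: "j < N" for c j
  proof -
    have "a \<le> ?X j" "?X j < ?X (j + 1)" "?X (j + 1) \<le> b"
      using mesh_nodes_bounds[OF m, of j] mesh_nodes_bounds[OF m, of "j + 1"] mesh_less[OF m, of j "j + 1"] j
      by auto
    moreover from this have "(LINT y:{a<..<b}|lebesgue. c * indicator {?X j<..<?X (j + 1)} y) =
        (LINT y:{?X j<..<?X (j + 1)}|lebesgue. c)"
      unfolding set_lebesgue_integral_def by (intro Bochner_Integration.integral_cong) (auto simp: indicator_def)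
    ultimately show ?thesis by (simp add: set_integral_const_Ioo)
  qed
  have "energy a b \<alpha> F (uh a b N u x) = (LINT y:{a<..<b}|lebesgue.
      (\<Sum>j<N. \<alpha> / 2 * (?D j)\<^sup>2 * indicator {?X j<..<?X (j + 1)} y) + F y (uh a b N u x y))"
    unfolding energy_def
  proof (rule set_integral_cong_finite[of "?X ` {..N}"])
    fix y assume y: "y \<in> {a<..<b}" "y \<notin> ?X ` {..N}"
    obtain i where i: "i < N" "y \<in> {?X i<..<?X (i + 1)}"
      using mesh_element_exists[OF m _ y] N by fastforce
    have "deriv (uh a b N u x) y = ?D i"
      using DERIV_imp_deriv[OF uh_has_derivative[OF m N y(2)]] mesh_sum_indicator[OF m i]
      by (simp add: slope_def)
    then show "\<alpha> / 2 * (deriv (uh a b N u x) y)\<^sup>2 + F y (uh a b N u x y) =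
        (\<Sum>j<N. \<alpha> / 2 * (?D j)\<^sup>2 * indicator {?X j<..<?X (j + 1)} y) + F y (uh a b N u x y)"
      using mesh_sum_indicator[OF m i, of "\<lambda>j. \<alpha> / 2 * (?D j)\<^sup>2"] by simp
  qed simp
  also have "\<dots> = (\<Sum>j<N. \<alpha> / 2 * (?D j)\<^sup>2 * (?X (j + 1) - ?X j)) +
      (LINT y:{a<..<b}|lebesgue. F y (uh a b N u x y))"
  proof (subst set_integral_add(2)[OF _ F_int])
    show "set_integrable lebesgue {a<..<b} (\<lambda>y. \<Sum>j<N. \<alpha> / 2 * (?D j)\<^sup>2 * indicator {?X j<..<?X (j + 1)} y)"
      by (rule set_integral_sum(1)) (rule ind)
    have "(LINT y:{a<..<b}|lebesgue. \<Sum>j<N. \<alpha> / 2 * (?D j)\<^sup>2 * indicator {?X j<..<?X (j + 1)} y) =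
        (\<Sum>j<N. LINT y:{a<..<b}|lebesgue. \<alpha> / 2 * (?D j)\<^sup>2 * indicator {?X j<..<?X (j + 1)} y)"
      by (rule set_integral_sum(2)) (rule ind)
    also have "\<dots> = (\<Sum>j<N. \<alpha> / 2 * (?D j)\<^sup>2 * (?X (j + 1) - ?X j))"
      by (intro sum.cong len) auto
    finally show "(LINT y:{a<..<b}|lebesgue. \<Sum>j<N. \<alpha> / 2 * (?D j)\<^sup>2 * indicator {?X j<..<?X (j + 1)} y) +
        (LINT y:{a<..<b}|lebesgue. F y (uh a b N u x y)) =
        (\<Sum>j<N. \<alpha> / 2 * (?D j)\<^sup>2 * (?X (j + 1) - ?X j)) + (LINT y:{a<..<b}|lebesgue. F y (uh a b N u x y))"
      by simp
  qed
  finally show ?thesis .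
qed

lemma has_some_gradient_energy:
  assumes m0: "mesh a b N x0" and N: "2 \<le> N"
    and F_deriv: "\<And>y v. y \<in> {a<..<b} \<Longrightarrow> (F y has_real_derivative f y v) (at v)"
    and f_lipschitz: "\<And>y v w. y \<in> {a<..<b} \<Longrightarrow> \<bar>f y v - f y w\<bar> \<le> L * \<bar>v - w\<bar>"
    and F_integrable: "\<And>v. v \<in> H10 a b \<Longrightarrow> set_integrable lebesgue {a<..<b} (\<lambda>y. F y (v y))"
    and f_integrable: "\<And>v w. v \<in> H10 a b \<Longrightarrow> w \<in> H10 a b \<Longrightarrow>
          set_integrable lebesgue {a<..<b} (\<lambda>y. f y (v y) * w y)"
  shows "has_some_gradient N (Eh a b \<alpha> F N) u0 x0"
proof (rule has_some_gradient_mesh_cong[OF _ m0])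
  show "has_some_gradient N (\<lambda>u x.
      (\<Sum>j<N. \<alpha> / 2 * (Dh (vals N u) (nodes a b N x) j)\<^sup>2 * (nodes a b N x (j + 1) - nodes a b N x j)) +
      (LINT y:{a<..<b}|lebesgue. F y (uh a b N u x y))) u0 x0"
    unfolding Dh_def power2_eq_square using m0
    by (intro gradient_intros
        has_some_gradient_potential[OF m0 N F_deriv f_lipschitz F_integrable f_integrable])
       (auto simp: mesh_def)
  show "(\<Sum>j<N. \<alpha> / 2 * (Dh (vals N u) (nodes a b N x) j)\<^sup>2 * (nodes a b N x (j + 1) - nodes a b N x j)) +
      (LINT y:{a<..<b}|lebesgue. F y (uh a b N u x y)) = Eh a b \<alpha> F N u x" if "mesh a b N x" for u x
    unfolding Eh_def by (intro energy_uh[symmetric] that N F_integrable uh_in_H10)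
qed

section \<open>The quadratic form of the ODE system\<close>

text \<open>
  The second block row contains \<open>hat X i * beta U X j\<close> where a square would have
  \<open>beta U X i * hat X j\<close>; the two agree off the nodes since \<open>beta = - slope * hat\<close> there.
\<close>

lemma mass_form_eq:
  fixes u p q :: "nat \<Rightarrow> real"
  assumes m: "mesh a b N x" and N: "2 \<le> N"
  defines "X \<equiv> nodes a b N x" and "U \<equiv> vals N u" and "n \<equiv> N - 1"
  shows "(\<Sum>i = 1..n. p i * ((\<Sum>j = 1..n. (LINT y:{a<..<b}|lebesgue. hat X i y * hat X j y) * p j) +
            (\<Sum>j = 1..n. (LINT y:{a<..<b}|lebesgue. hat X i y * beta U X j y) * q j))) +
         (\<Sum>i = 1..n. q i * ((\<Sum>j = 1..n. (LINT y:{a<..<b}|lebesgue. hat X i y * beta U X j y) * p j) +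
            (\<Sum>j = 1..n. (LINT y:{a<..<b}|lebesgue. beta U X i y * beta U X j y) * q j))) =
         (LINT y:{a<..<b}|lebesgue. (\<Sum>i = 1..n. (p i - slope a b N u x y * q i) * hat X i y)\<^sup>2)"
proof -
  define d where "d = slope a b N u x"
  have adj: "X (i - 1) < X i" "X i < X (i + 1)" if "i \<in> {1..n}" for i
    using that mesh_less[OF m, of "i - 1" i] mesh_less[OF m, of i "i + 1"] unfolding X_def n_def by auto
  have int: "set_integrable lebesgue {a<..<b} (\<lambda>y. d y ^ k * hat X i y * hat X j y)"
    if i: "i \<in> {1..n}" and j: "j \<in> {1..n}" for i j k
  proof (rule set_integrable_bounded_Ioo)
    have hm: "hat X i \<in> borel_measurable borel" if "i \<in> {1..n}" for i
      using continuous_on_hat[of X i UNIV] adj[OF that] by (intro borel_measurable_continuous_onI)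
    have "(\<lambda>y. d y ^ k * hat X i y * hat X j y) \<in> borel_measurable borel"
      using hm[OF i] hm[OF j] unfolding d_def by measurable
    then show "set_borel_measurable lebesgue {a<..<b} (\<lambda>y. d y ^ k * hat X i y * hat X j y)"
      by (rule set_borel_measurable_lebesgueI) auto
    fix y
    have hb: "\<bar>hat X i y\<bar> \<le> 1" if "i \<in> {1..n}" for i
      using hat_bounds[of X i y] adj[OF that] by simp
    show "\<bar>d y ^ k * hat X i y * hat X j y\<bar> \<le> (\<Sum>j<N. \<bar>Dh (vals N u) (nodes a b N x) j\<bar>) ^ k * 1 * 1"
      unfolding abs_mult power_abs d_def
      by (intro mult_mono power_mono slope_bound hb i j) (auto intro!: mult_nonneg_nonneg sum_nonneg)
  qed
  have "finite (X ` {..N})" by simp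
  note cong = set_integral_cong_finite[OF this, of "{a<..<b}"]
  have \<beta>: "beta U X k y = - d y * hat X k y" if "k \<in> {1..n}" "y \<in> {a<..<b}" "y \<notin> X ` {..N}" for k y
    using beta_eq_slope_hat[OF m] that unfolding U_def X_def d_def n_def by blast
  \<comment> \<open>Moments of products of hats, weighted with powers of the slope:
    \<open>k = 0, 1, 2\<close> yield the entries of \<open>matA\<close>, minus \<open>matB\<close>,
    and \<open>matC\<close>.\<close>
  define h where "h k i j = (LINT y:{a<..<b}|lebesgue. d y ^ k * hat X i y * hat X j y)" for k i j
  have A: "(LINT y:{a<..<b}|lebesgue. hat X i y * hat X j y) = h 0 i j" for i j
    by (simp add: h_def)
  have B: "(LINT y:{a<..<b}|lebesgue. hat X i y * beta U X j y) = - h 1 i j" if "j \<in> {1..n}" for i j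
  proof -
    have "(LINT y:{a<..<b}|lebesgue. hat X i y * beta U X j y) =
        (LINT y:{a<..<b}|lebesgue. (- 1) * (d y ^ 1 * hat X i y * hat X j y))"
      by (rule cong) (simp add: \<beta>[OF that])
    then show ?thesis unfolding h_def by (simp only: set_integral_mult_right)
  qed
  have C: "(LINT y:{a<..<b}|lebesgue. beta U X i y * beta U X j y) = h 2 i j"
    if "i \<in> {1..n}" "j \<in> {1..n}" for i j
    unfolding h_def by (rule cong) (simp add: \<beta>[OF that(1)] \<beta>[OF that(2)] power2_eq_square)
  \<comment> \<open>The product of the summands \<open>i\<close> and \<open>j\<close> of the squared
    sum, sorted by powers of the slope.\<close>
  let ?T = "\<lambda>i j y. p i * p j * (d y ^ 0 * hat X i y * hat X j y)
        - (p i * q j + q i * p j) * (d y ^ 1 * hat X i y * hat X j y)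
        + q i * q j * (d y ^ 2 * hat X i y * hat X j y)"
  have T: "set_integrable lebesgue {a<..<b} (?T i j)"
    "(LINT y:{a<..<b}|lebesgue. ?T i j y) =
       p i * p j * h 0 i j - (p i * q j + q i * p j) * h 1 i j + q i * q j * h 2 i j"
    if "i \<in> {1..n}" "j \<in> {1..n}" for i j
  proof -
    have I: "set_integrable lebesgue {a<..<b} (\<lambda>y. c * (d y ^ k * hat X i y * hat X j y))" for c k
      by (intro set_integrable_mult_right int that)
    show "set_integrable lebesgue {a<..<b} (?T i j)"
      by (intro set_integral_add(1) set_integral_diff(1) I)
    show "(LINT y:{a<..<b}|lebesgue. ?T i j y) =
       p i * p j * h 0 i j - (p i * q j + q i * p j) * h 1 i j + q i * q j * h 2 i j"
      unfolding h_def
      by (subst set_integral_add(2)[OF set_integral_diff(1)[OF I I] I],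
          subst set_integral_diff(2)[OF I I]) (simp only: set_integral_mult_right)
  qed
  have sq: "(\<Sum>i = 1..n. (p i - d y * q i) * hat X i y)\<^sup>2 = (\<Sum>i = 1..n. \<Sum>j = 1..n. ?T i j y)" for y
    unfolding power2_eq_square sum_product
    by (intro sum.cong refl) (simp add: power2_eq_square algebra_simps)
  have "(LINT y:{a<..<b}|lebesgue. (\<Sum>i = 1..n. (p i - d y * q i) * hat X i y)\<^sup>2) =
      (\<Sum>i = 1..n. LINT y:{a<..<b}|lebesgue. \<Sum>j = 1..n. ?T i j y)"
    unfolding sq by (intro set_integral_sum T)
  also have "\<dots> = (\<Sum>i = 1..n. \<Sum>j = 1..n. LINT y:{a<..<b}|lebesgue. ?T i j y)"
    by (intro sum.cong set_integral_sum T refl)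
  also have "\<dots> = (\<Sum>i = 1..n. \<Sum>j = 1..n.
      p i * p j * h 0 i j - (p i * q j + q i * p j) * h 1 i j + q i * q j * h 2 i j)"
    by (intro sum.cong refl T)
  also have "\<dots> = (\<Sum>i = 1..n. p i * ((\<Sum>j = 1..n. h 0 i j * p j) + (\<Sum>j = 1..n. - h 1 i j * q j))) +
      (\<Sum>i = 1..n. q i * ((\<Sum>j = 1..n. - h 1 i j * p j) + (\<Sum>j = 1..n. h 2 i j * q j)))"
    by (simp add: sum_distrib_left sum.distrib sum_subtractf sum_negf algebra_simps)
  finally show ?thesis
    unfolding d_def[symmetric] by (simp only: A B C cong: sum.cong)
qed

section \<open>From the ODE system to energy dissipation\<close>

lemma ode_components:
  assumes ode: "four_block_mat (matA a b N x) (matB a b N u x)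
      (matB a b N u x) (matC a b N u x + \<delta> \<cdot>\<^sub>m 1\<^sub>m (N - 1))
      *\<^sub>v (to_vec N p @\<^sub>v to_vec N q) = to_vec N r @\<^sub>v to_vec N s"
    and k: "k \<in> {1..N - 1}"
  defines "X \<equiv> nodes a b N x" and "U \<equiv> vals N u"
  shows "(\<Sum>j = 1..N - 1. (LINT y:{a<..<b}|lebesgue. hat X k y * hat X j y) * p j) +
      (\<Sum>j = 1..N - 1. (LINT y:{a<..<b}|lebesgue. hat X k y * beta U X j y) * q j) = r k"
    and "(\<Sum>j = 1..N - 1. (LINT y:{a<..<b}|lebesgue. hat X k y * beta U X j y) * p j) +
      (\<Sum>j = 1..N - 1. (LINT y:{a<..<b}|lebesgue. beta U X k y * beta U X j y) * q j) + \<delta> * q k = s k"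
proof -
  let ?n = "N - 1"
  have carrier: "matA a b N x \<in> carrier_mat ?n ?n" "matB a b N u x \<in> carrier_mat ?n ?n"
    "matC a b N u x \<in> carrier_mat ?n ?n" "to_vec N v \<in> carrier_vec ?n" for v
    by (simp_all add: matA_def matB_def matC_def to_vec_def Let_def)
  \<comment> \<open>Vector positions count from 0, so node \<open>k\<close> sits at position
    \<open>k - 1\<close>.\<close>
  obtain i where i: "k = Suc i" "i < ?n"
    using k by (cases k) auto
  have split: "(matA a b N x *\<^sub>v to_vec N p + matB a b N u x *\<^sub>v to_vec N q) @\<^sub>v
      (matB a b N u x *\<^sub>v to_vec N p + (matC a b N u x + \<delta> \<cdot>\<^sub>m 1\<^sub>m ?n) *\<^sub>v to_vec N q) =
      to_vec N r @\<^sub>v to_vec N s"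
    using ode carrier
    by (subst (asm) four_block_mat_mult_vec[where ?nr1.0 = ?n and ?nc1.0 = ?n and ?nr2.0 = ?n and ?nc2.0 = ?n]) auto
  have eqs: "matA a b N x *\<^sub>v to_vec N p + matB a b N u x *\<^sub>v to_vec N q = to_vec N r"
    "matB a b N u x *\<^sub>v to_vec N p + (matC a b N u x + \<delta> \<cdot>\<^sub>m 1\<^sub>m ?n) *\<^sub>v to_vec N q = to_vec N s"
    using append_vec_eq[of _ ?n "to_vec N r", THEN iffD1, OF _ _ split] carrier by auto
  have reindex: "(\<Sum>j = 1..?n. c j) = (\<Sum>j = 0..<?n. c (Suc j))" for c :: "nat \<Rightarrow> real"
    by (simp add: sum.atLeast1_atMost_eq atLeast0LessThan)
  have "vec_index (matA a b N x *\<^sub>v to_vec N p + matB a b N u x *\<^sub>v to_vec N q) i = vec_index (to_vec N r) i"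
    using eqs(1) by simp
  then show "(\<Sum>j = 1..N - 1. (LINT y:{a<..<b}|lebesgue. hat X k y * hat X j y) * p j) +
      (\<Sum>j = 1..N - 1. (LINT y:{a<..<b}|lebesgue. hat X k y * beta U X j y) * q j) = r k"
    using i unfolding reindex
    by (simp add: matA_def matB_def to_vec_def Let_def scalar_prod_def X_def U_def)
  have "vec_index (matB a b N u x *\<^sub>v to_vec N p + (matC a b N u x + \<delta> \<cdot>\<^sub>m 1\<^sub>m ?n) *\<^sub>v to_vec N q) i
      = vec_index (to_vec N s) i"
    using eqs(2) by simp
  then show "(\<Sum>j = 1..N - 1. (LINT y:{a<..<b}|lebesgue. hat X k y * beta U X j y) * p j) +
      (\<Sum>j = 1..N - 1. (LINT y:{a<..<b}|lebesgue. beta U X k y * beta U X j y) * q j) + \<delta> * q k = s k"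
    using i unfolding reindex
    by (simp add: matB_def matC_def to_vec_def Let_def scalar_prod_def X_def U_def
        distrib_right sum.distrib if_distrib[where f = "\<lambda>c. c * _"] if_distrib[where f = "\<lambda>c. _ * c"] cong: if_cong)
qed

text \<open>Linear independence of the hats: a continuous nonnegative function with zero integral
  vanishes on \<open>[a, b]\<close>, and the coefficients are the values at the nodes.\<close>

lemma uh_L2_norm_zero_imp_coeff_zero:
  assumes m: "mesh a b N x" and N: "2 \<le> N"
    and zero: "(LINT y:{a<..<b}|lebesgue. (uh a b N p x y)\<^sup>2) = 0" and k: "k \<in> {1..N - 1}"
  shows "p k = 0"
proof -
  let ?v = "\<lambda>y. (uh a b N p x y)\<^sup>2"
  have ab: "a < b" using mesh_less[OF m, of 0 N] N by simp
  have c: "continuous_on {a..b} ?v"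
    by (intro continuous_intros continuous_on_uh[OF m N])
  have "integral {a..b} ?v = 0"
    using set_lebesgue_integral_eq_integral(2)[OF set_integrable_continuous_Ioo[OF c]] zero
    by (simp add: integral_open_interval_real)
  then have "\<forall>y\<in>{a..b}. ?v y = 0"
    using integral_eq_0_iff[OF c ab] by simp
  then have "uh a b N p x (nodes a b N x k) = 0"
    using mesh_interior_nodes[OF m k] by auto
  then show ?thesis using uh_at_node[OF m k] by simp
qed

text \<open>At an end point belonging to \<open>T\<close> the derivatives are one-sided. Since
  \<open>T\<close> is an interval with nonempty interior, a derivative within \<open>T\<close> is
  unique, so \<open>D\<close> is the time derivative of the energy.\<close>

theorem theorem4p1:
  fixes a b \<alpha> \<xi> \<delta> L0 :: real
    and N :: nat
    and F f :: "real \<Rightarrow> real \<Rightarrow> real"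
    and T :: "real set"
    and u x u' x' :: "real \<Rightarrow> nat \<Rightarrow> real"
  assumes "a < b" and "\<alpha> > 0" and "\<xi> > 0" and "N \<ge> 2" and "L0 > 0" and "\<delta> > 0"
    and F_deriv: "\<And>y v. y \<in> {a<..<b} \<Longrightarrow> (F y has_real_derivative f y v) (at v)"
    and f_lipschitz: "\<And>y v w. y \<in> {a<..<b} \<Longrightarrow> \<bar>f y v - f y w\<bar> \<le> L0 * \<bar>v - w\<bar>"
    and F_integrable: "\<And>v. v \<in> H10 a b \<Longrightarrow> set_integrable lebesgue {a<..<b} (\<lambda>y. F y (v y))"
    and f_integrable: "\<And>v w. v \<in> H10 a b \<Longrightarrow> w \<in> H10 a b \<Longrightarrow>
          set_integrable lebesgue {a<..<b} (\<lambda>y. f y (v y) * w y)"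
    and time: "is_interval T" "interior T \<noteq> {}"
    and mesh: "\<And>t k. t \<in> T \<Longrightarrow> k < N \<Longrightarrow> nodes a b N (x t) k < nodes a b N (x t) (k + 1)"
    and u_deriv: "\<And>t k. t \<in> T \<Longrightarrow> k \<in> {1..N - 1} \<Longrightarrow>
          ((\<lambda>s. u s k) has_real_derivative u' t k) (at t within T)"
    and x_deriv: "\<And>t k. t \<in> T \<Longrightarrow> k \<in> {1..N - 1} \<Longrightarrow>
          ((\<lambda>s. x s k) has_real_derivative x' t k) (at t within T)"
    and ode: "\<And>t. t \<in> T \<Longrightarrow>
          four_block_mat
            (matA a b N (x t))       (matB a b N (u t) (x t))
            (matB a b N (u t) (x t)) (matC a b N (u t) (x t) + \<delta> \<cdot>\<^sub>m 1\<^sub>m (N - 1))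
          *\<^sub>v (to_vec N (u' t) @\<^sub>v to_vec N (x' t))
          = to_vec N (rhs_f a b \<alpha> \<xi> F N (u t) (x t)) @\<^sub>v to_vec N (rhs_g a b \<alpha> \<xi> F N (u t) (x t))"
  shows "\<forall>t\<in>T. \<exists>D.
           ((\<lambda>s. energy a b \<alpha> F (uh a b N (u s) (x s))) has_real_derivative D) (at t within T) \<and>
           D \<le> 0 \<and>
           (D = 0 \<longrightarrow> (\<forall>k\<in>{1..N - 1}. x' t k = 0 \<and> u' t k = 0))"
proof
  fix t assume t: "t \<in> T"
  have m: "mesh a b N (x t)" using mesh[OF t] by (simp add: mesh_def)
  let ?rf = "rhs_f a b \<alpha> \<xi> F N (u t) (x t)" and ?rg = "rhs_g a b \<alpha> \<xi> F N (u t) (x t)"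
  let ?d = "slope a b N (u t) (x t)" and ?X = "nodes a b N (x t)"
  obtain p q where E: "has_gradient N (Eh a b \<alpha> F N) (u t) (x t) p q"
    using has_some_gradient_energy[OF m \<open>N \<ge> 2\<close> F_deriv f_lipschitz F_integrable f_integrable]
    unfolding has_some_gradient_def by blast
  define D where "D = (\<Sum>k = 1..N - 1. p k * u' t k + q k * x' t k)"
  define M where "M = (LINT y:{a<..<b}|lebesgue. (\<Sum>i = 1..N - 1. (u' t i - ?d y * x' t i) * hat ?X i y)\<^sup>2)"
  have deriv: "((\<lambda>s. energy a b \<alpha> F (uh a b N (u s) (x s))) has_real_derivative D) (at t within T)"
    using has_gradientD[OF E u_deriv[OF t] x_deriv[OF t]] by (simp add: D_def Eh_def)
  \<comment> \<open>The right-hand sides are the partial derivatives times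
    \<open>- 1 / \<xi>\<close>, so the abstract gradient can be traded for them.\<close>
  have p: "p k = - \<xi> * ?rf k" and q: "q k = - \<xi> * ?rg k" if "k \<in> {1..N - 1}" for k
    using has_gradient_partials[OF E that] \<open>\<xi> > 0\<close> by (simp_all add: rhs_f_def rhs_g_def)
  \<comment> \<open>Upper rows are multiplied by \<open>u' t k\<close> and lower rows by
    \<open>x' t k\<close>, with the \<open>\<delta>\<close> term moved to the other side; what
    remains is the Gram form evaluated in \<open>mass_form_eq\<close>.\<close>
  have "(\<Sum>k = 1..N - 1. u' t k * ?rf k) + (\<Sum>k = 1..N - 1. x' t k * (?rg k - \<delta> * x' t k)) = M"
    unfolding M_def mass_form_eq[OF m \<open>N \<ge> 2\<close>, symmetric]
    using ode_components(1)[OF ode[OF t]] ode_components(2)[OF ode[OF t], folded eq_diff_eq]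
    by (intro arg_cong2[of _ _ _ _ "(+)"] sum.cong) auto
  then have rM: "(\<Sum>k = 1..N - 1. u' t k * ?rf k + x' t k * ?rg k) = M + \<delta> * (\<Sum>k = 1..N - 1. (x' t k)\<^sup>2)"
    by (simp add: sum.distrib sum_subtractf sum_distrib_left power2_eq_square algebra_simps)
  have "D = - \<xi> * (\<Sum>k = 1..N - 1. u' t k * ?rf k + x' t k * ?rg k)"
    unfolding D_def sum_distrib_left by (intro sum.cong) (auto simp: p q algebra_simps)
  then have D: "D = - \<xi> * (M + \<delta> * (\<Sum>k = 1..N - 1. (x' t k)\<^sup>2))"
    unfolding rM .
  have M0: "0 \<le> M"
    unfolding M_def set_lebesgue_integral_def by (intro integral_nonneg_AE AE_I2) simp
  have S0: "0 \<le> (\<Sum>k = 1..N - 1. (x' t k)\<^sup>2)" by (simp add: sum_nonneg)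
  have "D \<le> 0"
    unfolding D using M0 S0 \<open>\<xi> > 0\<close> \<open>\<delta> > 0\<close> by (simp add: mult_nonneg_nonneg)
  moreover have "x' t k = 0 \<and> u' t k = 0" if "D = 0" and k: "k \<in> {1..N - 1}" for k
  proof -
    have "M + \<delta> * (\<Sum>k = 1..N - 1. (x' t k)\<^sup>2) = 0"
      using \<open>D = 0\<close> \<open>\<xi> > 0\<close> unfolding D by simp
    then have "M = 0" and "(\<Sum>k = 1..N - 1. (x' t k)\<^sup>2) = 0"
      using M0 S0 \<open>\<delta> > 0\<close> by (simp_all add: add_nonneg_eq_0_iff)
    then have x0: "x' t k = 0" if "k \<in> {1..N - 1}" for k
      using that by (simp add: sum_nonneg_eq_0_iff)
    \<comment> \<open>With \<open>x' = 0\<close> the slope drops out, and the integrand is the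
      square of the piecewise linear function with nodal values \<open>u' t\<close>.\<close>
    have "M = (LINT y:{a<..<b}|lebesgue. (uh a b N (u' t) (x t) y)\<^sup>2)"
      unfolding M_def uh_def by (simp only: x0 mult_zero_right diff_zero cong: sum.cong)
    with \<open>M = 0\<close> have "u' t k = 0"
      using uh_L2_norm_zero_imp_coeff_zero[OF m \<open>N \<ge> 2\<close> _ k] by simp
    with x0[OF k] show ?thesis by simp
  qed
  ultimately show "\<exists>D. ((\<lambda>s. energy a b \<alpha> F (uh a b N (u s) (x s))) has_real_derivative D) (at t within T) \<and>
           D \<le> 0 \<and> (D = 0 \<longrightarrow> (\<forall>k\<in>{1..N - 1}. x' t k = 0 \<and> u' t k = 0))"
    using deriv by blast
qed

end
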